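(* Let $N\geq 3$, let $q>2N$ and $m\in[1,2_*]$, where $2_*=\frac{2N}{N+2}$. Let $\rho\in L^q(\mathbb{R}^N)\cap L^m(\mathbb{R}^N)$ and let $u_\rho\in\mathcal{X}$ be the unique minimizer on $\mathcal{X}$ of the functional $$I_\rho(u)=\int_{\mathbb{R}^N}\left(1-\sqrt{1-|\nabla u|^2}\right)dx-\int_{\mathbb{R}^N}\rho u\,dx .$$ Then $u_\rho\in W^{2,2}_{\mathrm{loc}}(\mathbb{R}^N)$.
   Context: $D^{1,2}(\mathbb{R}^N)$ denotes the completion of $C_c^\infty(\mathbb{R}^N)$ with respect to the norm $\left(\int_{\mathbb{R}^N}|\nabla u|^2dx\right)^{1/2}$. The space $\mathcal{X}$ is the convex set $\mathcal{X}=D^{1,2}(\mathbb{R}^N)\cap\{u\in C^{0,1}(\mathbb{R}^N):\ |\nabla u|_\infty\le 1\}$, endowed with the norm $\|u\|_{\mathcal X}=\left(\int_{\mathbb{R}^N}|\nabla u|^2dx\right)^{1/2}$. For such $\rho$, the functional $I_\rho$ is well defined on $\mathcal{X}$ and has a unique minimizer $u_\rho$ there. *)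

theory Defs
  imports "HOL-Analysis.Analysis"
begin

fun iter_partial :: "'a::euclidean_space list \<Rightarrow> ('a \<Rightarrow> real) \<Rightarrow> ('a \<Rightarrow> real)" where
  "iter_partial [] f = f"
| "iter_partial (b # bs) f = (\<lambda>x. deriv (\<lambda>t. iter_partial bs f (x + t *\<^sub>R b)) 0)"

definition partial :: "'a::euclidean_space \<Rightarrow> ('a \<Rightarrow> real) \<Rightarrow> ('a \<Rightarrow> real)" where
  "partial b f = iter_partial [b] f"

definition smooth_fun :: "('a::euclidean_space \<Rightarrow> real) \<Rightarrow> bool" where
  "smooth_fun f \<longleftrightarrow> (\<forall>bs. set bs \<subseteq> Basis \<longrightarrow> iter_partial bs f differentiable_on UNIV)"

definition test_fun :: "('a::euclidean_space \<Rightarrow> real) \<Rightarrow> bool" where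
  "test_fun \<phi> \<longleftrightarrow> smooth_fun \<phi> \<and> compact (closure {x. \<phi> x \<noteq> 0})"

definition grad_fun :: "('a::euclidean_space \<Rightarrow> real) \<Rightarrow> ('a \<Rightarrow> 'a)" where
  "grad_fun \<phi> = (\<lambda>x. \<Sum>b\<in>Basis. partial b \<phi> x *\<^sub>R b)"

definition Lp :: "real \<Rightarrow> ('a::euclidean_space \<Rightarrow> real) \<Rightarrow> bool" where
  "Lp p f \<longleftrightarrow> f \<in> borel_measurable lebesgue \<and> integrable lebesgue (\<lambda>x. \<bar>f x\<bar> powr p)"

definition L1_loc :: "('a::euclidean_space \<Rightarrow> real) \<Rightarrow> bool" where
  "L1_loc f \<longleftrightarrow> f \<in> borel_measurable lebesgue \<and>
     (\<forall>K. compact K \<longrightarrow> set_integrable lebesgue K f)"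

definition L2_loc :: "('a::euclidean_space \<Rightarrow> real) \<Rightarrow> bool" where
  "L2_loc f \<longleftrightarrow> f \<in> borel_measurable lebesgue \<and>
     (\<forall>K. compact K \<longrightarrow> set_integrable lebesgue K (\<lambda>x. (f x)\<^sup>2))"

definition has_weak_gradient :: "('a::euclidean_space \<Rightarrow> real) \<Rightarrow> ('a \<Rightarrow> 'a) \<Rightarrow> bool" where
  "has_weak_gradient u g \<longleftrightarrow> L1_loc u \<and> (\<forall>b\<in>Basis. L1_loc (\<lambda>x. g x \<bullet> b)) \<and>
     (\<forall>\<phi> b. test_fun \<phi> \<longrightarrow> b \<in> Basis \<longrightarrow>
        (\<integral>x. u x * partial b \<phi> x \<partial>lebesgue) = - (\<integral>x. (g x \<bullet> b) * \<phi> x \<partial>lebesgue))"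

definition weak_grad :: "('a::euclidean_space \<Rightarrow> real) \<Rightarrow> ('a \<Rightarrow> 'a)" where
  "weak_grad u = (SOME g. has_weak_gradient u g)"

text \<open>D^{1,2}(R^N), N >= 3: the completion of C_c^infinity under the Dirichlet norm,
  realised as functions u (in L^{2^*}) that are limits of test functions with
  gradients converging in L^2 to the weak gradient of u, and converging to u in L^{2^*}.\<close>
definition crit_exp :: "'a::euclidean_space itself \<Rightarrow> real" where
  "crit_exp _ = 2 * real DIM('a) / (real DIM('a) - 2)"

definition D12 :: "('a::euclidean_space \<Rightarrow> real) \<Rightarrow> bool" where
  "D12 u \<longleftrightarrow> (\<exists>g. has_weak_gradient u g \<and> Lp 2 (\<lambda>x. norm (g x)) \<and>
     (\<exists>\<phi>::nat \<Rightarrow> 'a \<Rightarrow> real. (\<forall>k. test_fun (\<phi> k)) \<and>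
        (\<lambda>k. \<integral>x. (norm (grad_fun (\<phi> k) x - g x))\<^sup>2 \<partial>lebesgue) \<longlonglongrightarrow> 0 \<and>
        (\<forall>k. integrable lebesgue (\<lambda>x. (norm (grad_fun (\<phi> k) x - g x))\<^sup>2)) \<and>
        (\<forall>k. integrable lebesgue (\<lambda>x. \<bar>\<phi> k x - u x\<bar> powr crit_exp TYPE('a))) \<and>
        (\<lambda>k. \<integral>x. \<bar>\<phi> k x - u x\<bar> powr crit_exp TYPE('a) \<partial>lebesgue) \<longlonglongrightarrow> 0))"

definition Xset :: "('a::euclidean_space \<Rightarrow> real) set" where
  "Xset = {u. D12 u \<and> (\<exists>L. L-lipschitz_on UNIV u) \<and>
       (\<exists>g. has_weak_gradient u g \<and> (AE x in lebesgue. norm (g x) \<le> 1))}"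

definition I_rho :: "('a::euclidean_space \<Rightarrow> real) \<Rightarrow> ('a \<Rightarrow> real) \<Rightarrow> real" where
  "I_rho \<rho> u = (\<integral>x. 1 - sqrt (1 - (norm (weak_grad u x))\<^sup>2) \<partial>lebesgue)
              - (\<integral>x. \<rho> x * u x \<partial>lebesgue)"

definition W22_loc :: "('a::euclidean_space \<Rightarrow> real) \<Rightarrow> bool" where
  "W22_loc u \<longleftrightarrow> L2_loc u \<and> (\<exists>g. has_weak_gradient u g \<and>
     (\<forall>b\<in>Basis. L2_loc (\<lambda>x. g x \<bullet> b)) \<and>
     (\<forall>b\<in>Basis. \<exists>h. has_weak_gradient (\<lambda>x. g x \<bullet> b) h \<and>
        (\<forall>b'\<in>Basis. L2_loc (\<lambda>x. h x \<bullet> b'))))"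

end

theory Submission
  imports Defs "HOL-Computational_Algebra.Polynomial"
begin

text \<open>The convex set of admissible functions is translation invariant, so for every increment \<open>h\<close>
  the mean of \<open>u\<close> and its translate \<open>u(\<cdot> + h)\<close> is an admissible competitor. No cut-off, which could
  violate the gradient constraint, is needed. Since the energy density is uniformly convex, adding the
  minimality inequalities for \<open>h\<close> and \<open>-h\<close> bounds the squared \<open>L\<^sup>2\<close>-norm \<open>D\<^sup>2\<close> of
  \<open>\<nabla>u(\<cdot> + h) - \<nabla>u\<close> by a multiple of the integral of \<open>\<rho>\<close> against the second difference
  \<open>2u - u(\<cdot> + h) - u(\<cdot> - h)\<close>. The \<open>L\<^sup>2\<close>-norm of the latter is at most a multiple of \<open>|h| D\<close>, and
  \<open>\<rho> \<in> L\<^sup>2\<close> by interpolation, so \<open>D \<le> C |h|\<close>. The difference quotients of \<open>\<nabla>u\<close> are thus bounded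
  in \<open>L\<^sup>2\<close>, and a weak limit of them is the weak derivative of \<open>\<nabla>u\<close>.\<close>

section \<open>Translations of Lebesgue measure\<close>

text \<open>The derivative of the density 1 - sqrt (1 - |p|^2) blows up as |p| tends to 1, so an
  Euler-Lagrange equation for the minimizer cannot be taken for granted; the proof only compares
  energies. One minimality inequality alone bounds D^2 by the pairing of rho with a first difference
  of u. That pairing is O(|h|), which yields no more than D = O(|h|^(1/2)). Adding the inequality
  for -h produces a second difference, that is, a first difference of u(. + h) - u. Its norm carries
  a factor |h| and also a factor D, and one D cancels. The hypotheses do not place u itself in L^2.
  The bound for second differences is therefore proved for approximating test functions and passed
  to u by Fatou's lemma. The linear term is finite because 2N/(N+2) is conjugate to the critical
  Sobolev exponent 2N/(N-2), for which u is integrable.\<close>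

lemma lebesgue_measurable_shift [measurable]:
  "(\<lambda>x::'a::euclidean_space. x + h) \<in> lebesgue \<rightarrow>\<^sub>M lebesgue"
  using lebesgue_affine_measurable[of "\<lambda>_. 1" h]
  by (simp add: euclidean_representation add.commute)

lemma distr_lebesgue_shift:
  "distr lebesgue lebesgue (\<lambda>x::'a::euclidean_space. x + h) = lebesgue"
  using lebesgue_affine_euclidean[of "\<lambda>_. 1" h]
  by (simp add: euclidean_representation add.commute density_1)

lemma lebesgue_AE_shift:
  fixes P :: "'a::euclidean_space \<Rightarrow> bool"
  assumes "AE x in lebesgue. P x"
  shows "AE x in lebesgue. P (x + h)"
proof -
  have "AE x in distr lebesgue lebesgue (\<lambda>x::'a. x + h). P x"
    using assms by (simp only: distr_lebesgue_shift)
  from AE_distrD[OF lebesgue_measurable_shift this] show ?thesis .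
qed

lemma lebesgue_integrable_shift:
  fixes f :: "'a::euclidean_space \<Rightarrow> 'b::{banach, second_countable_topology}"
  assumes "integrable lebesgue f"
  shows "integrable lebesgue (\<lambda>x. f (x + h))"
proof (rule integrable_distr[OF lebesgue_measurable_shift])
  show "integrable (distr lebesgue lebesgue (\<lambda>x::'a. x + h)) f"
    using assms by (simp only: distr_lebesgue_shift)
qed

lemma lebesgue_measurable_shift_fun:
  fixes f :: "'a::euclidean_space \<Rightarrow> 'b::topological_space"
  assumes "f \<in> borel_measurable lebesgue"
  shows "(\<lambda>x. f (x + h)) \<in> borel_measurable lebesgue"
  using measurable_compose[OF lebesgue_measurable_shift assms] .

lemma lebesgue_integral_shift:
  fixes f :: "'a::euclidean_space \<Rightarrow> 'b::{banach, second_countable_topology}"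
  assumes "f \<in> borel_measurable lebesgue"
  shows "(\<integral>x. f (x + h) \<partial>lebesgue) = (\<integral>x. f x \<partial>lebesgue)"
  using integral_distr[OF lebesgue_measurable_shift assms, of h]
  by (simp only: distr_lebesgue_shift)

section \<open>Test functions\<close>

lemma smooth_fun_partial_differentiable:
  assumes "smooth_fun f" "set bs \<subseteq> Basis"
  shows "iter_partial bs f differentiable (at x)"
  using assms unfolding smooth_fun_def by (simp add: differentiable_on_def)

text \<open>\<open>iter_partial\<close> differentiates only at parameter 0. Moving the base point
  along the line gives the derivative at every parameter, which the mean value estimate for
  increments needs.\<close>

lemma line_differentiable:
  fixes f :: "'a::euclidean_space \<Rightarrow> real"
  assumes "f differentiable (at (x + s *\<^sub>R b))"
  shows "((\<lambda>t. f (x + t *\<^sub>R b)) has_real_derivative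
           deriv (\<lambda>t. f (x + s *\<^sub>R b + t *\<^sub>R b)) 0) (at s)"
proof -
  obtain D where D: "(f has_derivative D) (at (x + s *\<^sub>R b))"
    using assms by (auto simp: differentiable_def)
  have lin: "D (t *\<^sub>R b) = D b * t" for t
    using has_derivative_linear[OF D] by (simp add: linear_cmul)
  have "((\<lambda>t. f (x + t *\<^sub>R b)) has_derivative (\<lambda>t. D (t *\<^sub>R b))) (at s)"
    by (rule has_derivative_compose[where f="\<lambda>t. x + t *\<^sub>R b" and g=f])
       (auto intro!: derivative_eq_intros D)
  then have 1: "((\<lambda>t. f (x + t *\<^sub>R b)) has_real_derivative D b) (at s)"
    by (simp add: has_field_derivative_def lin[abs_def])
  have "((\<lambda>t. f (x + s *\<^sub>R b + t *\<^sub>R b)) has_derivative (\<lambda>t. D (t *\<^sub>R b))) (at 0)"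
    by (rule has_derivative_compose[where f="\<lambda>t. x + s *\<^sub>R b + t *\<^sub>R b" and g=f])
       (use D in \<open>auto intro!: derivative_eq_intros\<close>)
  then have "((\<lambda>t. f (x + s *\<^sub>R b + t *\<^sub>R b)) has_real_derivative D b) (at 0)"
    by (simp add: has_field_derivative_def lin[abs_def])
  with 1 show ?thesis by (simp add: DERIV_imp_deriv)
qed

text \<open>Translation only renames the base point, so both sides apply \<open>deriv\<close> to the
  same function, whether or not a derivative exists. Linear combinations are different: there each
  order needs genuine derivatives, hence smoothness.\<close>

lemma iter_partial_shift:
  "iter_partial bs (\<lambda>x. f (x + h)) = (\<lambda>x. iter_partial bs f (x + h))"
proof (induction bs)
  case (Cons b bs)
  have eq: "x + t *\<^sub>R b + h = x + h + t *\<^sub>R b" for x t by (simp add: ac_simps)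
  show ?case by (simp add: Cons.IH eq)
qed simp

lemma smooth_fun_shift:
  assumes "smooth_fun f"
  shows "smooth_fun (\<lambda>x. f (x + h))"
  unfolding smooth_fun_def iter_partial_shift
proof (intro allI impI)
  fix bs :: "'a list" assume bs: "set bs \<subseteq> Basis"
  show "(\<lambda>x. iter_partial bs f (x + h)) differentiable_on UNIV"
    unfolding differentiable_on_def
    using differentiable_compose[of "iter_partial bs f" "\<lambda>x. x + h"]
      smooth_fun_partial_differentiable[OF assms bs] by auto
qed

lemma iter_partial_lincomb:
  assumes "smooth_fun f" "smooth_fun g" "set bs \<subseteq> Basis"
  shows "iter_partial bs (\<lambda>x. a * f x + c * g x)
       = (\<lambda>x. a * iter_partial bs f x + c * iter_partial bs g x)"
  using assms(3)
proof (induction bs)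
  case (Cons b bs)
  show ?case
  proof
    fix x
    have 1: "((\<lambda>t. iter_partial bs f (x + t *\<^sub>R b)) has_real_derivative iter_partial (b # bs) f x) (at 0)"
      using line_differentiable[where s=0 and x=x and b=b, of "iter_partial bs f"]
        smooth_fun_partial_differentiable[OF assms(1), of bs] Cons.prems by simp
    have 2: "((\<lambda>t. iter_partial bs g (x + t *\<^sub>R b)) has_real_derivative iter_partial (b # bs) g x) (at 0)"
      using line_differentiable[where s=0 and x=x and b=b, of "iter_partial bs g"]
        smooth_fun_partial_differentiable[OF assms(2), of bs] Cons.prems by simp
    have "((\<lambda>t. a * iter_partial bs f (x + t *\<^sub>R b) + c * iter_partial bs g (x + t *\<^sub>R b))
        has_real_derivative a * iter_partial (b # bs) f x + c * iter_partial (b # bs) g x) (at 0)"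
      by (intro DERIV_add DERIV_cmult 1 2)
    then show "iter_partial (b # bs) (\<lambda>x. a * f x + c * g x) x
        = a * iter_partial (b # bs) f x + c * iter_partial (b # bs) g x"
      using Cons by (simp add: DERIV_imp_deriv)
  qed
qed simp

lemma smooth_fun_lincomb:
  assumes "smooth_fun f" "smooth_fun g"
  shows "smooth_fun (\<lambda>x. a * f x + c * g x)"
  unfolding smooth_fun_def differentiable_on_def
  using iter_partial_lincomb[OF assms] smooth_fun_partial_differentiable[OF assms(1)]
    smooth_fun_partial_differentiable[OF assms(2)]
  by (auto intro!: derivative_intros)

lemma test_fun_iff:
  "test_fun \<phi> \<longleftrightarrow> smooth_fun \<phi> \<and> bounded {x. \<phi> x \<noteq> 0}"
  by (simp add: test_fun_def compact_closure)

lemma test_fun_shift: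
  assumes "test_fun \<phi>"
  shows "test_fun (\<lambda>x. \<phi> (x + h))"
proof -
  have "bounded ((\<lambda>x. x - h) ` {x. \<phi> x \<noteq> 0})"
    using assms bounded_translation_minus[of "{x. \<phi> x \<noteq> 0}" h] by (simp add: test_fun_iff)
  moreover have "{x. \<phi> (x + h) \<noteq> 0} \<subseteq> (\<lambda>x. x - h) ` {x. \<phi> x \<noteq> 0}"
    by (force simp: image_iff)
  ultimately show ?thesis
    using assms bounded_subset by (auto simp: test_fun_iff smooth_fun_shift)
qed

lemma test_fun_lincomb:
  assumes "test_fun \<phi>" "test_fun \<psi>"
  shows "test_fun (\<lambda>x. a * \<phi> x + c * \<psi> x)"
proof -
  have "{x. a * \<phi> x + c * \<psi> x \<noteq> 0} \<subseteq> {x. \<phi> x \<noteq> 0} \<union> {x. \<psi> x \<noteq> 0}" by auto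
  then show ?thesis
    using assms bounded_subset[OF bounded_Un[THEN iffD2]] by (auto simp: test_fun_iff smooth_fun_lincomb)
qed

lemma partial_shift: "partial b (\<lambda>x. f (x + h)) = (\<lambda>x. partial b f (x + h))"
  unfolding partial_def by (rule iter_partial_shift)

lemma partial_lincomb:
  assumes "smooth_fun f" "smooth_fun g" "b \<in> Basis"
  shows "partial b (\<lambda>x. a * f x + c * g x) = (\<lambda>x. a * partial b f x + c * partial b g x)"
  unfolding partial_def by (rule iter_partial_lincomb) (use assms in auto)

lemma grad_fun_shift: "grad_fun (\<lambda>x. f (x + h)) = (\<lambda>x. grad_fun f (x + h))"
  unfolding grad_fun_def partial_shift by simp

lemma grad_fun_lincomb:
  assumes "smooth_fun f" "smooth_fun g"
  shows "grad_fun (\<lambda>x. a * f x + c * g x) = (\<lambda>x. a *\<^sub>R grad_fun f x + c *\<^sub>R grad_fun g x)"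
  unfolding grad_fun_def
  by (simp add: partial_lincomb[OF assms] scaleR_add_left sum.distrib scaleR_sum_right)

lemma grad_fun_inner: "b \<in> Basis \<Longrightarrow> grad_fun f x \<bullet> b = partial b f x"
  unfolding grad_fun_def by (simp add: inner_sum_left inner_Basis if_distrib sum.delta cong: if_cong)

section \<open>Regularity, supports and integrability of test functions\<close>

lemma partial_line:
  assumes "smooth_fun \<phi>"
  shows "((\<lambda>t. \<phi> (x + t *\<^sub>R b)) has_real_derivative partial b \<phi> (x + s *\<^sub>R b)) (at s)"
  using line_differentiable[of \<phi> x s b] smooth_fun_partial_differentiable[OF assms, of "[]"]
  by (simp add: partial_def)

lemma smooth_fun_continuous: "smooth_fun \<phi> \<Longrightarrow> continuous_on UNIV \<phi>"
  by (metis differentiable_imp_continuous_on iter_partial.simps(1) list.set(1) empty_subsetI smooth_fun_def)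

lemma partial_continuous:
  assumes "smooth_fun \<phi>" "b \<in> Basis"
  shows "continuous_on UNIV (partial b \<phi>)"
  unfolding partial_def
  using smooth_fun_partial_differentiable[OF assms(1), of "[b]"] assms(2)
  by (intro differentiable_imp_continuous_on) (simp add: differentiable_on_def)

lemma test_fun_support:
  assumes "test_fun \<phi>"
  obtains R where "R > 0" "\<And>x. norm x > R \<Longrightarrow> \<phi> x = 0" "\<And>x b. norm x > R \<Longrightarrow> partial b \<phi> x = 0"
proof -
  obtain R where R: "R > 0" "\<And>x. \<phi> x \<noteq> 0 \<Longrightarrow> norm x \<le> R"
    using assms by (auto simp: test_fun_iff bounded_pos)
  have "partial b \<phi> x = 0" if x: "norm x > R" for x b
  proof -
    \<comment> \<open>The parameters for which the line stays outside the ball form an open set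
      containing 0. The function vanishes along it, hence so does its derivative, and one radius
      serves all directions.\<close>
    have op: "open {t. norm (x + t *\<^sub>R b) > R}"
      by (intro open_Collect_less continuous_intros)
    have "((\<lambda>t. \<phi> (x + t *\<^sub>R b)) has_real_derivative 0) (at 0)"
      by (rule has_field_derivative_transform_within_open[OF DERIV_const[of 0] op])
         (use x R in force)+
    then show ?thesis by (simp add: partial_def DERIV_imp_deriv)
  qed
  then show ?thesis using R that[of R] by force
qed

lemma compact_support_bounded:
  fixes f :: "'a::euclidean_space \<Rightarrow> real"
  assumes "continuous_on UNIV f" "\<And>x. norm x > R \<Longrightarrow> f x = 0"
  obtains B where "B > 0" "\<And>x. \<bar>f x\<bar> \<le> B"
proof -
  have "bounded (f ` cball 0 R)"
    by (meson assms(1) compact_cball compact_continuous_image compact_imp_bounded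
        continuous_on_subset top_greatest)
  then obtain B where B: "B > 0" "\<And>x. norm x \<le> R \<Longrightarrow> \<bar>f x\<bar> \<le> B"
    by (auto simp: bounded_pos)
  have "\<bar>f x\<bar> \<le> B" for x using B assms(2)[of x] by (cases "norm x \<le> R") auto
  with B show ?thesis using that by blast
qed

lemma integrable_compact_support:
  fixes f :: "'a::euclidean_space \<Rightarrow> real"
  assumes "continuous_on UNIV f" "\<And>x. norm x > R \<Longrightarrow> f x = 0"
  shows "integrable lebesgue f"
proof -
  have "integrable lborel (\<lambda>x. indicator (cball 0 R) x *\<^sub>R f x)"
    by (rule borel_integrable_compact) (auto intro: continuous_on_subset[OF assms(1)])
  moreover have "(\<lambda>x. indicator (cball 0 R) x *\<^sub>R f x) = f"
    using assms(2) by (auto simp: fun_eq_iff indicator_def)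
  ultimately show ?thesis
    by (simp add: integrable_completion)
qed

lemma continuous_borel_lebesgue:
  fixes f :: "'a::euclidean_space \<Rightarrow> 'b::topological_space"
  shows "continuous_on UNIV f \<Longrightarrow> f \<in> borel_measurable lebesgue"
  by (intro measurable_completion) (simp add: borel_measurable_continuous_onI)

subsection \<open>Bump functions\<close>

text \<open>The classical exp(-1/x) extended by zero. The polynomial in 1/x makes the family closed
  under differentiation.\<close>

definition flat :: "real poly \<Rightarrow> real \<Rightarrow> real" where
  "flat p x = (if x > 0 then poly p (1 / x) * exp (- (1 / x)) else 0)"

lemma poly_times_exp_tendsto_0:
  "((\<lambda>y::real. poly q y * exp (- y)) \<longlongrightarrow> 0) at_top"
proof -
  have "((\<lambda>y::real. \<Sum>i\<le>degree q. coeff q i * (y ^ i / exp y)) \<longlongrightarrow> (\<Sum>i\<le>degree q. coeff q i * 0)) at_top"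
    by (intro tendsto_intros tendsto_power_div_exp_0)
  then show ?thesis
    by (simp add: poly_altdef sum_distrib_right exp_minus divide_inverse mult.assoc)
qed

text \<open>In the variable y = 1/x one has d/dx = - y^2 d/dy, and differentiating p(y) exp(-y) in y
  gives (p' - p) exp(-y). The factor \<open>[:0,0,1:]\<close> is y^2.\<close>

lemma flat_has_derivative:
  "(flat p has_real_derivative flat ([:0,0,1:] * (p - pderiv p)) x) (at x)"
proof -
  consider "x > 0" | "x < 0" | "x = 0" by linarith
  then show ?thesis
  proof cases
    case 1
    have "((\<lambda>x. poly p (1 / x) * exp (- (1 / x))) has_real_derivative
        flat ([:0,0,1:] * (p - pderiv p)) x) (at x)"
      using 1 by (auto intro!: derivative_eq_intros simp: flat_def field_simps power2_eq_square)
    then show ?thesis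
      by (rule has_field_derivative_transform_within_open[of _ _ _ "{0<..}"])
         (use 1 in \<open>auto simp: flat_def\<close>)
  next
    case 2
    then have "flat ([:0,0,1:] * (p - pderiv p)) x = 0" by (simp add: flat_def)
    moreover have "(flat p has_real_derivative 0) (at x)"
      by (rule has_field_derivative_transform_within_open[OF DERIV_const[of 0], of "{..<0}"])
         (use 2 in \<open>auto simp: flat_def\<close>)
    ultimately show ?thesis by simp
  next
    case 3
    \<comment> \<open>With h = 1/y the difference quotient at 0 from the right is y p(y) exp(-y);
      \<open>pCons 0 p\<close> is the polynomial y p(y).\<close>
    have lim: "((\<lambda>x. poly (pCons 0 p) (inverse x) * exp (- inverse x)) \<longlongrightarrow> 0) (at_right 0)"
      by (rule filterlim_compose[OF poly_times_exp_tendsto_0 filterlim_inverse_at_top_right])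
    have r: "((\<lambda>h. (flat p (0 + h) - flat p 0) / h) \<longlongrightarrow> 0) (at_right 0)"
      by (rule Lim_transform_eventually[OF lim])
         (auto simp: eventually_at_right_less flat_def field_simps intro!: eventually_at_rightI[of 0 1])
    have l: "((\<lambda>h. (flat p (0 + h) - flat p 0) / h) \<longlongrightarrow> 0) (at_left 0)"
      by (rule Lim_transform_eventually[OF tendsto_const])
         (auto simp: flat_def intro!: eventually_at_leftI[of "-1" 0])
    have "((\<lambda>h. (flat p (0 + h) - flat p 0) / h) \<longlongrightarrow> 0) (at 0)"
      using l r by (rule filterlim_split_at)
    then have "(flat p has_real_derivative 0) (at 0)"
      by (simp add: DERIV_def)
    then show ?thesis using 3 by (simp add: flat_def)
  qed
qed

text \<open>An algebra of functions closed under directional derivatives; all its members are therefore smooth.\<close>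

inductive flat_alg :: "('a::euclidean_space \<Rightarrow> real) \<Rightarrow> bool" where
  flat: "flat_alg (\<lambda>x. flat p (c \<bullet> x + d))"
| const: "flat_alg (\<lambda>x. k)"
| add: "flat_alg f \<Longrightarrow> flat_alg g \<Longrightarrow> flat_alg (\<lambda>x. f x + g x)"
| mult: "flat_alg f \<Longrightarrow> flat_alg g \<Longrightarrow> flat_alg (\<lambda>x. f x * g x)"

text \<open>The direction is the first argument of \<open>D\<close>, so that \<open>D h\<close> is a
  function of the point and can re-enter the algebra. Full derivatives are tracked because
  \<open>smooth_fun\<close> asks for differentiability of every iterated partial derivative.\<close>

lemma flat_alg_derivative:
  "flat_alg f \<Longrightarrow> \<exists>D. (\<forall>x. (f has_derivative (\<lambda>h. D h x)) (at x)) \<and> (\<forall>h. flat_alg (D h))"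
proof (induction rule: flat_alg.induct)
  case (flat p c d)
  let ?q = "[:0,0,1:] * (p - pderiv p)"
  have "((\<lambda>x. flat p (c \<bullet> x + d)) has_derivative (\<lambda>h. (c \<bullet> h) * flat ?q (c \<bullet> x + d))) (at x)" for x
  proof -
    have "((\<lambda>x. flat p (c \<bullet> x + d)) has_derivative (\<lambda>h. flat ?q (c \<bullet> x + d) * (c \<bullet> h))) (at x)"
      by (rule has_derivative_compose[where f="\<lambda>x. c \<bullet> x + d" and g="flat p",
            OF _ has_field_derivative_imp_has_derivative[OF flat_has_derivative]])
         (auto intro!: derivative_eq_intros)
    then show ?thesis by (simp add: mult.commute)
  qed
  moreover have "flat_alg (\<lambda>x. (c \<bullet> h) * flat ?q (c \<bullet> x + d))" for h
    by (intro flat_alg.intros)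
  ultimately show ?case
    by (intro exI[of _ "\<lambda>h x. (c \<bullet> h) * flat ?q (c \<bullet> x + d)"]) blast
next
  case (const k)
  show ?case by (intro exI[of _ "\<lambda>h x. 0"]) (auto intro: flat_alg.intros)
next
  case (add f g)
  then obtain D E where "\<forall>x. (f has_derivative (\<lambda>h. D h x)) (at x)" "\<forall>h. flat_alg (D h)"
    "\<forall>x. (g has_derivative (\<lambda>h. E h x)) (at x)" "\<forall>h. flat_alg (E h)" by blast
  then show ?case
    by (intro exI[of _ "\<lambda>h x. D h x + E h x"]) (auto intro!: flat_alg.intros has_derivative_add)
next
  case (mult f g)
  then obtain D E where "\<forall>x. (f has_derivative (\<lambda>h. D h x)) (at x)" "\<forall>h. flat_alg (D h)"
    "\<forall>x. (g has_derivative (\<lambda>h. E h x)) (at x)" "\<forall>h. flat_alg (E h)" by blast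
  with mult.hyps show ?case
    by (intro exI[of _ "\<lambda>h x. f x * E h x + D h x * g x"]) (auto intro!: flat_alg.intros has_derivative_mult)
qed

lemma flat_alg_iter_partial: "flat_alg f \<Longrightarrow> flat_alg (iter_partial bs f)"
proof (induction bs)
  case (Cons b bs)
  then obtain D where D: "\<And>x. (iter_partial bs f has_derivative (\<lambda>h. D h x)) (at x)" "\<And>h. flat_alg (D h)"
    using flat_alg_derivative by blast
  have "iter_partial (b # bs) f x = D b x" for x
  proof -
    have "((\<lambda>t. iter_partial bs f (x + t *\<^sub>R b)) has_derivative (\<lambda>t. D (t *\<^sub>R b) x)) (at 0)"
      by (rule has_derivative_compose[where f="\<lambda>t. x + t *\<^sub>R b" and g="iter_partial bs f"])
         (use D(1) in \<open>auto intro!: derivative_eq_intros\<close>)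
    moreover have "D (t *\<^sub>R b) x = D b x * t" for t
      using linear_cmul[OF has_derivative_linear[OF D(1)[of x]], of t b] by simp
    ultimately have "((\<lambda>t. iter_partial bs f (x + t *\<^sub>R b)) has_real_derivative D b x) (at 0)"
      by (simp add: has_field_derivative_def)
    then show ?thesis by (simp add: DERIV_imp_deriv)
  qed
  then have "iter_partial (b # bs) f = D b" by auto
  then show ?case using D(2) by simp
qed simp

lemma flat_alg_smooth:
  assumes "flat_alg f"
  shows "smooth_fun f"
  unfolding smooth_fun_def differentiable_on_def differentiable_def
  using flat_alg_derivative[OF flat_alg_iter_partial[OF assms]] by (metis (no_types))

lemma flat_alg_prod:
  "finite I \<Longrightarrow> (\<And>i. i \<in> I \<Longrightarrow> flat_alg (f i)) \<Longrightarrow> flat_alg (\<lambda>x. \<Prod>i\<in>I. f i x)"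
  by (induction I rule: finite_induct) (auto intro: flat_alg.intros)

text \<open>The support stays in one box while the slope parameter grows, so these functions,
  bounded by 1, tend pointwise to the indicator of the open box. \<open>Suc n\<close> keeps the
  parameter positive.\<close>

definition box_bump :: "'a::euclidean_space \<Rightarrow> 'a \<Rightarrow> nat \<Rightarrow> 'a \<Rightarrow> real" where
  "box_bump a c n x = (\<Prod>b\<in>Basis. flat 1 (real (Suc n) * (x \<bullet> b - a \<bullet> b)) * flat 1 (real (Suc n) * (c \<bullet> b - x \<bullet> b)))"

lemma flat_1_bounds: "0 \<le> flat 1 x" "flat 1 x \<le> 1"
  by (auto simp: flat_def)

lemma box_bump_bounds: "0 \<le> box_bump a c n x" "box_bump a c n x \<le> 1"
  unfolding box_bump_def
  by (auto intro!: prod_nonneg prod_le_1 mult_le_one simp: flat_1_bounds)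

lemma box_bump_outside:
  assumes "x \<notin> box a c"
  shows "box_bump a c n x = 0"
proof -
  obtain b where b: "b \<in> Basis" "x \<bullet> b - a \<bullet> b \<le> 0 \<or> c \<bullet> b - x \<bullet> b \<le> 0"
    using assms by (force simp: mem_box)
  have "flat 1 (real (Suc n) * y) = 0" if "y \<le> 0" for y
    using that by (auto simp: flat_def zero_less_mult_iff simp del: of_nat_Suc)
  then show ?thesis
    unfolding box_bump_def using b by (intro prod_zero bexI[of _ b]) (auto simp del: of_nat_Suc)
qed

lemma box_bump_tendsto:
  "(\<lambda>n. box_bump a c n x) \<longlonglongrightarrow> indicator (box a c) x"
proof (cases "x \<in> box a c")
  case False
  then show ?thesis by (simp add: box_bump_outside)
next
  case True
  have lim: "(\<lambda>n. flat 1 (real (Suc n) * y)) \<longlonglongrightarrow> 1" if "y > 0" for y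
  proof -
    have "(\<lambda>n. exp (- ((1 / y) * inverse (real (Suc n))))) \<longlonglongrightarrow> exp (- ((1 / y) * 0))"
      by (intro tendsto_intros LIMSEQ_inverse_real_of_nat)
    moreover have "flat 1 (real (Suc n) * y) = exp (- ((1 / y) * inverse (real (Suc n))))" for n
      using that by (auto simp: flat_def divide_inverse mult_ac)
    ultimately show ?thesis by simp
  qed
  have "(\<lambda>n. box_bump a c n x) \<longlonglongrightarrow> (\<Prod>b\<in>(Basis::'a set). 1 * 1)"
    unfolding box_bump_def
    by (intro tendsto_prod tendsto_mult lim) (use True in \<open>auto simp: mem_box\<close>)
  then show ?thesis using True by simp
qed

lemma box_bump_test_fun: "test_fun (box_bump a c n)"
proof -
  have "flat_alg (\<lambda>x. flat 1 (real (Suc n) * (x \<bullet> b - a \<bullet> b)) * flat 1 (real (Suc n) * (c \<bullet> b - x \<bullet> b)))" for b :: 'a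
  proof -
    have "flat_alg (\<lambda>x. flat 1 ((real (Suc n) *\<^sub>R b) \<bullet> x + (- real (Suc n) * (a \<bullet> b)))
        * flat 1 ((- real (Suc n) *\<^sub>R b) \<bullet> x + real (Suc n) * (c \<bullet> b)))"
      by (intro flat_alg.intros)
    then show ?thesis by (simp add: algebra_simps inner_commute)
  qed
  then have "flat_alg (box_bump a c n)"
    unfolding box_bump_def[abs_def] by (intro flat_alg_prod) auto
  moreover have "{x. box_bump a c n x \<noteq> 0} \<subseteq> box a c"
    using box_bump_outside by blast
  ultimately show ?thesis
    unfolding test_fun_iff using flat_alg_smooth bounded_subset bounded_box by blast
qed

section \<open>Weak gradients\<close>

lemma L1_loc_mult_integrable:
  assumes "L1_loc f" "continuous_on UNIV \<psi>" "\<And>x. norm x > R \<Longrightarrow> \<psi> x = 0"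
  shows "integrable lebesgue (\<lambda>x. f x * \<psi> x)"
proof -
  obtain B where B: "B > 0" "\<And>x. \<bar>\<psi> x\<bar> \<le> B"
    using compact_support_bounded[OF assms(2,3)] by blast
  have int: "integrable lebesgue (\<lambda>x. B * (indicator (cball 0 R) x *\<^sub>R f x))"
    using assms(1) unfolding L1_loc_def set_integrable_def by (intro integrable_mult_right) auto
  have [measurable]: "f \<in> borel_measurable lebesgue" "\<psi> \<in> borel_measurable lebesgue"
    using assms(1) continuous_borel_lebesgue[OF assms(2)] by (auto simp: L1_loc_def)
  show ?thesis
  proof (rule Bochner_Integration.integrable_bound[OF int])
    show "AE x in lebesgue. norm (f x * \<psi> x) \<le> norm (B * (indicator (cball 0 R) x *\<^sub>R f x))"
    proof (rule AE_I2)
      fix x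
      show "norm (f x * \<psi> x) \<le> norm (B * (indicator (cball 0 R) x *\<^sub>R f x))"
        using assms(3)[of x] B(1) mult_right_mono[OF B(2)[of x], of "\<bar>f x\<bar>"]
        by (cases "norm x \<le> R") (auto simp: abs_mult mult.commute)
    qed
  qed simp
qed

lemma L1_loc_test_integrable:
  assumes "L1_loc f" "test_fun \<phi>"
  shows "integrable lebesgue (\<lambda>x. f x * \<phi> x)"
    and "b \<in> Basis \<Longrightarrow> integrable lebesgue (\<lambda>x. f x * partial b \<phi> x)"
proof -
  obtain R where R: "R > 0" "\<And>x. norm x > R \<Longrightarrow> \<phi> x = 0" "\<And>x b. norm x > R \<Longrightarrow> partial b \<phi> x = 0"
    using test_fun_support[OF assms(2)] by metis
  have sm: "smooth_fun \<phi>" using assms(2) by (simp add: test_fun_def)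
  show "integrable lebesgue (\<lambda>x. f x * \<phi> x)"
    using L1_loc_mult_integrable[OF assms(1) smooth_fun_continuous[OF sm], of R] R(2) by simp
  show "integrable lebesgue (\<lambda>x. f x * partial b \<phi> x)" if "b \<in> Basis"
    using L1_loc_mult_integrable[OF assms(1) partial_continuous[OF sm that], of R] R(3) by simp
qed

lemma L1_loc_shift:
  assumes "L1_loc f"
  shows "L1_loc (\<lambda>x. f (x + h))"
  unfolding L1_loc_def
proof (intro conjI allI impI)
  show "(\<lambda>x. f (x + h)) \<in> borel_measurable lebesgue"
    using assms by (auto simp: L1_loc_def intro: lebesgue_measurable_shift_fun)
  fix K :: "'a set" assume "compact K"
  then have "compact ((\<lambda>x. x + h) ` K)"
    by (intro compact_continuous_image continuous_intros)
  then have "integrable lebesgue (\<lambda>x. indicator ((\<lambda>x. x + h) ` K) x *\<^sub>R f x)"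
    using assms by (auto simp: L1_loc_def set_integrable_def)
  from lebesgue_integrable_shift[OF this, of h]
  show "set_integrable lebesgue K (\<lambda>x. f (x + h))"
    by (simp add: set_integrable_def indicator_def image_iff)
qed

lemma L1_loc_lincomb:
  assumes "L1_loc f" "L1_loc g"
  shows "L1_loc (\<lambda>x. a * f x + c * g x)"
  unfolding L1_loc_def
proof (intro conjI allI impI)
  show "(\<lambda>x. a * f x + c * g x) \<in> borel_measurable lebesgue"
    using assms by (intro borel_measurable_add borel_measurable_times borel_measurable_const) (auto simp: L1_loc_def)
  fix K :: "'a set" assume "compact K"
  then show "set_integrable lebesgue K (\<lambda>x. a * f x + c * g x)"
    using assms by (intro set_integral_add(1) set_integrable_mult_right) (auto simp: L1_loc_def)
qed

text \<open>Testing with box bumps and passing to the limit by dominated convergence shows that the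
  integral over every box vanishes. Lebesgue differentiation then recovers the values of
  \<open>f\<close> almost everywhere, without mollifiers.\<close>

theorem fundamental_lemma:
  fixes f :: "'a::euclidean_space \<Rightarrow> real"
  assumes f: "L1_loc f" and 0: "\<And>\<phi>. test_fun \<phi> \<Longrightarrow> (\<integral>x. f x * \<phi> x \<partial>lebesgue) = 0"
  shows "AE x in lebesgue. f x = 0"
proof -
  have [measurable]: "f \<in> borel_measurable lebesgue" using f by (simp add: L1_loc_def)
  have si: "set_integrable lebesgue (cbox a c) f" for a c
    using f by (auto simp: L1_loc_def)
  have box0: "integral (cbox a c) f = 0" for a c
  proof -
    have "(\<lambda>n. \<integral>x. f x * box_bump a c n x \<partial>lebesgue) \<longlonglongrightarrow> (\<integral>x. f x * indicator (box a c) x \<partial>lebesgue)"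
    proof (rule integral_dominated_convergence)
      show "integrable lebesgue (\<lambda>x. norm (indicator (cbox a c) x *\<^sub>R f x))"
        using si[of a c] by (intro integrable_norm) (simp add: set_integrable_def)
      show "AE x in lebesgue. (\<lambda>n. f x * box_bump a c n x) \<longlonglongrightarrow> f x * indicator (box a c) x"
        by (intro AE_I2 tendsto_mult tendsto_const box_bump_tendsto)
      show "AE x in lebesgue. norm (f x * box_bump a c n x) \<le> norm (indicator (cbox a c) x *\<^sub>R f x)" for n
      proof (rule AE_I2)
        fix x
        show "norm (f x * box_bump a c n x) \<le> norm (indicator (cbox a c) x *\<^sub>R f x)"
          using box_bump_bounds[of a c n x] box_bump_outside[of x a c n] box_subset_cbox[of a c]
          by (cases "x \<in> box a c") (auto simp: abs_mult mult_left_le)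
      qed
      show "(\<lambda>x. f x * box_bump a c n x) \<in> borel_measurable lebesgue" for n
        using L1_loc_test_integrable(1)[OF f box_bump_test_fun] by auto
      show "(\<lambda>x. f x * indicator (box a c) x) \<in> borel_measurable lebesgue"
        by (intro borel_measurable_times borel_measurable_indicator) auto
    qed
    then have "(\<integral>x. f x * indicator (box a c) x \<partial>lebesgue) = 0"
      using 0[OF box_bump_test_fun] by (simp add: LIMSEQ_const_iff)
    moreover have "set_integrable lebesgue (box a c) f"
      by (rule set_integrable_subset[OF si[of a c]]) (auto simp: box_subset_cbox)
    ultimately have "integral (box a c) f = 0"
      using set_lebesgue_integral_eq_integral(2)[of "box a c" f]
      by (simp add: set_lebesgue_integral_def mult.commute)
    then show ?thesis by (simp add: integral_open_interval)
  qed
  have "f integrable_on cbox a c" for a c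
    using si by (rule set_lebesgue_integral_eq_integral(1))
  \<comment> \<open>Lebesgue differentiation for cubes with corner x, valid off a negligible
    set.\<close>
  then obtain N where N: "negligible N" "\<And>x e. \<lbrakk>x \<notin> N; 0 < e\<rbrakk> \<Longrightarrow>
      \<exists>d>0. \<forall>h. 0 < h \<and> h < d \<longrightarrow> norm (integral (cbox x (x + h *\<^sub>R One)) f /\<^sub>R h ^ DIM('a) - f x) < e"
    using integrable_ccontinuous_explicit[of f] by blast
  have "f x = 0" if x: "x \<notin> N" for x
  proof (rule ccontr)
    assume "f x \<noteq> 0"
    then obtain d where "d > 0" and d: "\<forall>h. 0 < h \<and> h < d \<longrightarrow>
        norm (integral (cbox x (x + h *\<^sub>R One)) f /\<^sub>R h ^ DIM('a) - f x) < \<bar>f x\<bar>"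
      using N(2)[OF x, of "\<bar>f x\<bar>"] by auto
    \<comment> \<open>All cube averages are 0, so the estimate at any admissible side length reads
      |f x| < |f x|.\<close>
    with d[rule_format, of "d/2"] show False by (simp add: box0)
  qed
  then show ?thesis
    using N(1) by (intro AE_I'[of N]) (auto simp: negligible_iff_null_sets)
qed

text \<open>Weak gradients enter from three independent sources: the witness in \<open>D12\<close>,
  the bounded witness in \<open>Xset\<close>, and the arbitrary choice in \<open>weak_grad\<close>.
  Uniqueness lets them be exchanged.\<close>

lemma weak_gradient_unique:
  fixes g g' :: "'a::euclidean_space \<Rightarrow> 'a"
  assumes "has_weak_gradient u g" "has_weak_gradient u g'"
  shows "AE x in lebesgue. g x = g' x"
proof -
  have "AE x in lebesgue. g x \<bullet> b = g' x \<bullet> b" if b: "b \<in> Basis" for b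
  proof -
    have L: "L1_loc (\<lambda>x. g x \<bullet> b)" "L1_loc (\<lambda>x. g' x \<bullet> b)"
      using assms b by (auto simp: has_weak_gradient_def)
    have "AE x in lebesgue. 1 * (g x \<bullet> b) + (-1) * (g' x \<bullet> b) = 0"
    proof (rule fundamental_lemma)
      show "L1_loc (\<lambda>x. 1 * (g x \<bullet> b) + (-1) * (g' x \<bullet> b))"
        by (rule L1_loc_lincomb[OF L])
      fix \<phi> :: "'a \<Rightarrow> real" assume \<phi>: "test_fun \<phi>"
      have "(\<integral>x. (1 * (g x \<bullet> b) + (-1) * (g' x \<bullet> b)) * \<phi> x \<partial>lebesgue)
          = (\<integral>x. (g x \<bullet> b) * \<phi> x - (g' x \<bullet> b) * \<phi> x \<partial>lebesgue)"
        by (simp add: left_diff_distrib)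
      also have "\<dots> = (\<integral>x. (g x \<bullet> b) * \<phi> x \<partial>lebesgue) - (\<integral>x. (g' x \<bullet> b) * \<phi> x \<partial>lebesgue)"
        by (intro Bochner_Integration.integral_diff L1_loc_test_integrable L \<phi>)
      also have "\<dots> = 0"
        using assms \<phi> b by (simp add: has_weak_gradient_def)
      finally show "(\<integral>x. (1 * (g x \<bullet> b) + (-1) * (g' x \<bullet> b)) * \<phi> x \<partial>lebesgue) = 0" .
    qed
    then show ?thesis by simp
  qed
  then have "AE x in lebesgue. \<forall>b\<in>Basis. g x \<bullet> b = g' x \<bullet> b"
    by (intro AE_finite_allI) auto
  then show ?thesis by eventually_elim (auto intro: euclidean_eqI)
qed

lemma weak_grad_AE_eq:
  assumes "has_weak_gradient u g"
  shows "AE x in lebesgue. weak_grad u x = g x"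
  unfolding weak_grad_def
  by (rule weak_gradient_unique[OF someI[of "has_weak_gradient u", OF assms] assms])

section \<open>Measurability, translation and linearity of weak gradients\<close>

lemma has_weak_gradient_measurable:
  assumes "has_weak_gradient u g"
  shows "u \<in> borel_measurable lebesgue" "g \<in> borel_measurable lebesgue"
  using assms unfolding has_weak_gradient_def L1_loc_def borel_measurable_euclidean_space[of g] by blast+

lemma has_weak_gradient_shift:
  fixes u :: "'a::euclidean_space \<Rightarrow> real"
  assumes "has_weak_gradient u g"
  shows "has_weak_gradient (\<lambda>x. u (x + h)) (\<lambda>x. g (x + h))"
proof -
  have L: "L1_loc u" "\<And>b. b \<in> Basis \<Longrightarrow> L1_loc (\<lambda>x. g x \<bullet> b)"
    using assms by (auto simp: has_weak_gradient_def)
  have "(\<integral>x. u (x + h) * partial b \<phi> x \<partial>lebesgue) = - (\<integral>x. (g (x + h) \<bullet> b) * \<phi> x \<partial>lebesgue)"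
    if \<phi>: "test_fun \<phi>" and b: "b \<in> Basis" for \<phi> b
  proof -
    \<comment> \<open>Translating the test function back turns both sides into integrals of
      translated functions, to which invariance of the measure applies.\<close>
    let ?\<psi> = "\<lambda>x. \<phi> (x + (- h))"
    have \<psi>: "test_fun ?\<psi>" by (rule test_fun_shift[OF \<phi>])
    have "(\<integral>x. u (x + h) * partial b \<phi> x \<partial>lebesgue) = (\<integral>x. u (x + h) * partial b ?\<psi> (x + h) \<partial>lebesgue)"
      unfolding partial_shift by simp
    also have "\<dots> = (\<integral>x. u x * partial b ?\<psi> x \<partial>lebesgue)"
      using lebesgue_integral_shift[of "\<lambda>x. u x * partial b ?\<psi> x"] L1_loc_test_integrable(2)[OF L(1) \<psi> b] by auto
    also have "\<dots> = - (\<integral>x. (g x \<bullet> b) * ?\<psi> x \<partial>lebesgue)"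
      using assms \<psi> b by (simp add: has_weak_gradient_def)
    also have "(\<integral>x. (g x \<bullet> b) * ?\<psi> x \<partial>lebesgue) = (\<integral>x. (g (x + h) \<bullet> b) * ?\<psi> (x + h) \<partial>lebesgue)"
      using lebesgue_integral_shift[of "\<lambda>x. (g x \<bullet> b) * ?\<psi> x" h, symmetric]
        L1_loc_test_integrable(1)[OF L(2)[OF b] \<psi>] by auto
    finally show ?thesis by simp
  qed
  then show ?thesis
    using L1_loc_shift[OF L(1)] L1_loc_shift[OF L(2)] by (auto simp: has_weak_gradient_def)
qed

lemma has_weak_gradient_lincomb:
  fixes u v :: "'a::euclidean_space \<Rightarrow> real"
  assumes "has_weak_gradient u g" "has_weak_gradient v k"
  shows "has_weak_gradient (\<lambda>x. a * u x + c * v x) (\<lambda>x. a *\<^sub>R g x + c *\<^sub>R k x)"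
proof -
  have L: "L1_loc u" "\<And>b. b \<in> Basis \<Longrightarrow> L1_loc (\<lambda>x. g x \<bullet> b)"
    "L1_loc v" "\<And>b. b \<in> Basis \<Longrightarrow> L1_loc (\<lambda>x. k x \<bullet> b)"
    using assms by (auto simp: has_weak_gradient_def)
  have "(\<integral>x. (a * u x + c * v x) * partial b \<phi> x \<partial>lebesgue)
      = - (\<integral>x. ((a *\<^sub>R g x + c *\<^sub>R k x) \<bullet> b) * \<phi> x \<partial>lebesgue)"
    if \<phi>: "test_fun \<phi>" and b: "b \<in> Basis" for \<phi> b
  proof -
    note i = L1_loc_test_integrable(2)[OF L(1) \<phi> b] L1_loc_test_integrable(2)[OF L(3) \<phi> b]
      L1_loc_test_integrable(1)[OF L(2)[OF b] \<phi>] L1_loc_test_integrable(1)[OF L(4)[OF b] \<phi>]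
    have "(\<integral>x. (a * u x + c * v x) * partial b \<phi> x \<partial>lebesgue)
        = (\<integral>x. a * (u x * partial b \<phi> x) + c * (v x * partial b \<phi> x) \<partial>lebesgue)"
      by (simp add: algebra_simps)
    also have "\<dots> = a * (\<integral>x. u x * partial b \<phi> x \<partial>lebesgue) + c * (\<integral>x. v x * partial b \<phi> x \<partial>lebesgue)"
      using i by simp
    also have "\<dots> = a * - (\<integral>x. (g x \<bullet> b) * \<phi> x \<partial>lebesgue) + c * - (\<integral>x. (k x \<bullet> b) * \<phi> x \<partial>lebesgue)"
      using assms \<phi> b by (simp add: has_weak_gradient_def)
    also have "\<dots> = - (\<integral>x. a * ((g x \<bullet> b) * \<phi> x) + c * ((k x \<bullet> b) * \<phi> x) \<partial>lebesgue)"
      using i by simp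
    also have "\<dots> = - (\<integral>x. ((a *\<^sub>R g x + c *\<^sub>R k x) \<bullet> b) * \<phi> x \<partial>lebesgue)"
      by (simp add: algebra_simps)
    finally show ?thesis .
  qed
  moreover have "L1_loc (\<lambda>x. (a *\<^sub>R g x + c *\<^sub>R k x) \<bullet> b)" if "b \<in> Basis" for b
    using L1_loc_lincomb[OF L(2)[OF that] L(4)[OF that], of a c] by (simp add: inner_add_left)
  ultimately show ?thesis
    using L1_loc_lincomb[OF L(1,3)] by (auto simp: has_weak_gradient_def)
qed

section \<open>Square-integrable functions\<close>

text \<open>Squares instead of \<open>powr 2\<close>, so that expanding a square is plain ring
  arithmetic and no absolute values appear.\<close>

definition L2 :: "'a measure \<Rightarrow> ('a \<Rightarrow> real) \<Rightarrow> bool" where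
  "L2 M f \<longleftrightarrow> f \<in> borel_measurable M \<and> integrable M (\<lambda>x. (f x)\<^sup>2)"

lemma L2_mult:
  assumes "L2 M f" "L2 M g"
  shows "integrable M (\<lambda>x. f x * g x)"
proof -
  have [measurable]: "f \<in> borel_measurable M" "g \<in> borel_measurable M"
    using assms by (auto simp: L2_def)
  have "integrable M (\<lambda>x. (f x)\<^sup>2 + (g x)\<^sup>2)"
    using assms by (auto simp: L2_def)
  then show ?thesis
  proof (rule Bochner_Integration.integrable_bound)
    have "\<bar>a * b\<bar> \<le> \<bar>a\<^sup>2 + b\<^sup>2\<bar>" for a b :: real
    proof -
      have "2 * \<bar>a * b\<bar> \<le> a\<^sup>2 + b\<^sup>2"
        using sum_squares_bound[of "\<bar>a\<bar>" "\<bar>b\<bar>"] by (simp add: abs_mult)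
      then show ?thesis by simp
    qed
    then show "AE x in M. norm (f x * g x) \<le> norm ((f x)\<^sup>2 + (g x)\<^sup>2)" by simp
  qed simp
qed

lemma L2_lincomb:
  assumes "L2 M f" "L2 M g"
  shows "L2 M (\<lambda>x. a * f x + c * g x)"
proof -
  have [measurable]: "f \<in> borel_measurable M" "g \<in> borel_measurable M"
    using assms by (auto simp: L2_def)
  have eq: "(a * f x + c * g x)\<^sup>2 = a\<^sup>2 * (f x)\<^sup>2 + 2 * a * c * (f x * g x) + c\<^sup>2 * (g x)\<^sup>2" for x
    by (simp add: power2_eq_square algebra_simps)
  show ?thesis
    unfolding L2_def eq using assms L2_mult[OF assms] by (auto simp: L2_def)
qed

lemma L2_integral_lincomb:
  assumes "L2 M f" "L2 M g"
  shows "(\<integral>x. (a * f x + c * g x)\<^sup>2 \<partial>M)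
    = a\<^sup>2 * (\<integral>x. (f x)\<^sup>2 \<partial>M) + 2 * a * c * (\<integral>x. f x * g x \<partial>M) + c\<^sup>2 * (\<integral>x. (g x)\<^sup>2 \<partial>M)"
proof -
  have eq: "(a * f x + c * g x)\<^sup>2 = a\<^sup>2 * (f x)\<^sup>2 + 2 * a * c * (f x * g x) + c\<^sup>2 * (g x)\<^sup>2" for x
    by (simp add: power2_eq_square algebra_simps)
  show ?thesis
    unfolding eq using assms L2_mult[OF assms] by (simp add: L2_def)
qed

lemma L2_Cauchy_Schwarz:
  assumes "L2 M f" "L2 M g"
  shows "(\<integral>x. f x * g x \<partial>M)\<^sup>2 \<le> (\<integral>x. (f x)\<^sup>2 \<partial>M) * (\<integral>x. (g x)\<^sup>2 \<partial>M)"
proof -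
  define A B C where "A = (\<integral>x. (f x)\<^sup>2 \<partial>M)" and "B = (\<integral>x. f x * g x \<partial>M)" and "C = (\<integral>x. (g x)\<^sup>2 \<partial>M)"
  have q: "a\<^sup>2 * A + 2 * a * c * B + c\<^sup>2 * C \<ge> 0" for a c
    unfolding A_def B_def C_def L2_integral_lincomb[OF assms, symmetric] by simp
  have C: "C \<ge> 0" unfolding C_def by simp
  show ?thesis
  proof (cases "C = 0")
    case True
    have "B = 0"
    proof (rule ccontr)
      assume "B \<noteq> 0"
      \<comment> \<open>For C = 0 the form is A + 2 c B at a = 1; this c makes it equal to
        -1.\<close>
      with q[of 1 "- (A + 1) / (2 * B)"] True show False by (simp add: field_simps)
    qed
    then show ?thesis using True by (simp add: B_def C_def)
  next
    case False
    \<comment> \<open>The form is evaluated at a = C, c = -B, which is the minimizing c for this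
      a.\<close>
    then have "C * (C * A - B\<^sup>2) \<ge> 0"
      using q[of C "- B"] by (simp add: power2_eq_square algebra_simps)
    then have "C * A - B\<^sup>2 \<ge> 0"
      using C False by (simp add: zero_le_mult_iff)
    then show ?thesis by (simp add: A_def B_def C_def mult.commute)
  qed
qed

section \<open>Lower semicontinuity and completeness of L^2\<close>

lemma L2_abs: "L2 M f \<Longrightarrow> L2 M (\<lambda>x. \<bar>f x\<bar>)"
  by (auto simp: L2_def)

text \<open>Fatou's lemma for the squares. The bounds may vary with \<open>n\<close>, so that an
  approximation error contained in them disappears in the limit.\<close>

lemma L2_Fatou:
  assumes f: "\<And>n::nat. L2 M (f n)" and bd: "\<And>n. (\<integral>x. (f n x)\<^sup>2 \<partial>M) \<le> c n" and c: "c \<longlonglongrightarrow> C"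
    and G: "G \<in> borel_measurable M" and lim: "AE x in M. (\<lambda>n. f n x) \<longlonglongrightarrow> G x"
  shows "L2 M G" "(\<integral>x. (G x)\<^sup>2 \<partial>M) \<le> C"
proof -
  have [measurable]: "f n \<in> borel_measurable M" for n using f by (auto simp: L2_def)
  have c0: "0 \<le> c n" for n using bd[of n] by (rule order_trans[rotated]) simp
  have C0: "0 \<le> C" using LIMSEQ_le_const[OF c] c0 by blast
  have "(\<integral>\<^sup>+x. ennreal ((G x)\<^sup>2) \<partial>M) = (\<integral>\<^sup>+x. liminf (\<lambda>n. ennreal ((f n x)\<^sup>2)) \<partial>M)"
  proof (rule nn_integral_cong_AE)
    show "AE x in M. ennreal ((G x)\<^sup>2) = liminf (\<lambda>n. ennreal ((f n x)\<^sup>2))"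
      using lim
    proof eventually_elim
      case (elim x)
      then have "(\<lambda>n. ennreal ((f n x)\<^sup>2)) \<longlonglongrightarrow> ennreal ((G x)\<^sup>2)"
        by (intro tendsto_ennrealI tendsto_power)
      then show ?case by (intro lim_imp_Liminf[symmetric]) auto
    qed
  qed
  also have "\<dots> \<le> liminf (\<lambda>n. \<integral>\<^sup>+x. ennreal ((f n x)\<^sup>2) \<partial>M)"
    by (rule nn_integral_liminf) measurable
  also have "\<dots> \<le> liminf (\<lambda>n. ennreal (c n))"
  proof (intro Liminf_mono always_eventually allI)
    fix n
    have "(\<integral>\<^sup>+x. ennreal ((f n x)\<^sup>2) \<partial>M) = ennreal (\<integral>x. (f n x)\<^sup>2 \<partial>M)"
      using f[of n] by (intro nn_integral_eq_integral) (auto simp: L2_def)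
    then show "(\<integral>\<^sup>+x. ennreal ((f n x)\<^sup>2) \<partial>M) \<le> ennreal (c n)"
      using bd[of n] by (simp add: ennreal_leI)
  qed
  also have "\<dots> = ennreal C"
    using c by (intro lim_imp_Liminf tendsto_ennrealI) auto
  finally have *: "(\<integral>\<^sup>+x. ennreal ((G x)\<^sup>2) \<partial>M) \<le> ennreal C" .
  have "integrable M (\<lambda>x. (G x)\<^sup>2)"
    using * G by (intro integrableI_bounded) (auto simp: ennreal_less_top le_less_trans[OF _ ennreal_less_top])
  then show L: "L2 M G" using G by (auto simp: L2_def)
  have "ennreal (\<integral>x. (G x)\<^sup>2 \<partial>M) \<le> ennreal C"
    using * L nn_integral_eq_integral[of M "\<lambda>x. (G x)\<^sup>2"] by (simp add: L2_def)
  then show "(\<integral>x. (G x)\<^sup>2 \<partial>M) \<le> C" using C0 by (simp add: ennreal_le_iff)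
qed

text \<open>The whole space has infinite measure, so L^2 is not contained in L^1. Multiplying by
  such a weight maps L^2 into L^1 and, the weight being positive, loses no pointwise information. It
  is the root of a positive integrable function, which exists by sigma-finiteness.\<close>

lemma lebesgue_positive_L2_weight:
  obtains w :: "'a::euclidean_space \<Rightarrow> real" where "L2 lebesgue w" "\<And>x. w x > 0"
proof -
  obtain h :: "'a \<Rightarrow> ennreal" where h: "h \<in> borel_measurable lborel" "integral\<^sup>N lborel h \<noteq> \<infinity>"
    "\<And>x. 0 < h x \<and> h x < \<infinity>"
    using sigma_finite_measure.Ex_finite_integrable_function[OF sigma_finite_lborel] by auto
  have [measurable]: "h \<in> borel_measurable lebesgue" using h(1) by (rule measurable_completion)
  let ?w = "\<lambda>x. sqrt (enn2real (h x))"
  have sq: "(?w x)\<^sup>2 = enn2real (h x)" for x by simp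
  have "(\<integral>\<^sup>+x. ennreal (enn2real (h x)) \<partial>lebesgue) = integral\<^sup>N lborel h"
    using h(3) by (simp add: nn_integral_completion less_top[symmetric])
  then have "integrable lebesgue (\<lambda>x. (?w x)\<^sup>2)"
    unfolding sq using h(2) by (intro integrableI_nonneg) (auto simp: less_top)
  then have "L2 lebesgue ?w" by (auto simp: L2_def)
  moreover have "?w x > 0" for x
    using h(3)[of x] by (simp add: enn2real_positive_iff)
  ultimately show ?thesis using that by blast
qed

lemma L2_diff: "L2 M f \<Longrightarrow> L2 M g \<Longrightarrow> L2 M (\<lambda>x. f x - g x)"
  using L2_lincomb[of M f g 1 "-1"] by simp

text \<open>By Cauchy-Schwarz the weighted sequence is Cauchy in L^1, so a subsequence is Cauchy
  almost everywhere. Dividing by the weight gives the pointwise limit. Applying Fatou's lemma along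
  the subsequence, with the other index fixed, upgrades this to L^2 convergence of the full
  sequence.\<close>

theorem L2_complete:
  fixes f :: "nat \<Rightarrow> 'a::euclidean_space \<Rightarrow> real"
  assumes f: "\<And>n. L2 lebesgue (f n)"
    and cau: "\<And>e. e > 0 \<Longrightarrow> \<exists>N. \<forall>i\<ge>N. \<forall>j\<ge>N. (\<integral>x. (f i x - f j x)\<^sup>2 \<partial>lebesgue) < e"
  obtains G where "L2 lebesgue G" "(\<lambda>n. \<integral>x. (f n x - G x)\<^sup>2 \<partial>lebesgue) \<longlonglongrightarrow> 0"
proof -
  obtain w :: "'a \<Rightarrow> real" where w: "L2 lebesgue w" "\<And>x. w x > 0"
    using lebesgue_positive_L2_weight by blast
  \<comment> \<open>Adding 1 makes it possible to divide by \<open>W\<close> without first showing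
    that the weight has positive norm.\<close>
  define W where "W = (\<integral>x. (w x)\<^sup>2 \<partial>lebesgue) + 1"
  have W: "W > 0" "(\<integral>x. (w x)\<^sup>2 \<partial>lebesgue) \<le> W"
    by (auto simp: W_def intro: add_nonneg_pos)
  have [measurable]: "f n \<in> borel_measurable lebesgue" for n using f by (auto simp: L2_def)
  obtain r where r: "strict_mono r" "AE x in lebesgue. Cauchy (\<lambda>i. f (r i) x * w x)"
  proof (rule cauchy_L1_AE_cauchy_subseq[where s="\<lambda>n x. f n x * w x" and M=lebesgue])
    show "integrable lebesgue (\<lambda>x. f n x * w x)" for n by (rule L2_mult[OF f w(1)])
    fix e :: real assume e: "e > 0"
    \<comment> \<open>Cauchy-Schwarz bounds the squared L^1 distance by \<open>W\<close> times the
      squared L^2 distance, hence the threshold e^2 / W.\<close>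
    obtain N where N: "\<And>i j. i \<ge> N \<Longrightarrow> j \<ge> N \<Longrightarrow> (\<integral>x. (f i x - f j x)\<^sup>2 \<partial>lebesgue) < e\<^sup>2 / W"
      using cau[of "e\<^sup>2 / W"] e W by auto
    have "(\<integral>x. norm (f i x * w x - f j x * w x) \<partial>lebesgue) < e" if "i \<ge> N" "j \<ge> N" for i j
    proof -
      have "norm (f i x * w x - f j x * w x) = \<bar>f i x - f j x\<bar> * w x" for x
        using w(2)[of x] by (simp add: left_diff_distrib[symmetric] abs_mult)
      then have "(\<integral>x. norm (f i x * w x - f j x * w x) \<partial>lebesgue)\<^sup>2
          = (\<integral>x. \<bar>f i x - f j x\<bar> * w x \<partial>lebesgue)\<^sup>2" by simp
      also have "\<dots> \<le> (\<integral>x. (\<bar>f i x - f j x\<bar>)\<^sup>2 \<partial>lebesgue) * (\<integral>x. (w x)\<^sup>2 \<partial>lebesgue)"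
        by (intro L2_Cauchy_Schwarz L2_abs L2_diff f w)
      also have "\<dots> \<le> (\<integral>x. (f i x - f j x)\<^sup>2 \<partial>lebesgue) * W"
        using W by (intro mult_mono) auto
      also have "\<dots> < e\<^sup>2 / W * W"
        using N[OF that] W by (intro mult_strict_right_mono) auto
      also have "\<dots> = e\<^sup>2" using W by simp
      finally show ?thesis using e by (simp add: power2_less_imp_less)
    qed
    then show "\<exists>N. \<forall>i\<ge>N. \<forall>j\<ge>N. (\<integral>x. norm (f i x * w x - f j x * w x) \<partial>lebesgue) < e" by blast
  qed
  \<comment> \<open>Where the subsequence diverges the value of \<open>lim\<close> is unspecified,
    but this happens only on a null set, and \<open>lim\<close> keeps \<open>G\<close>
    measurable.\<close>
  define G where "G x = lim (\<lambda>i. f (r i) x)" for x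
  have [measurable]: "G \<in> borel_measurable lebesgue"
    unfolding G_def[abs_def] by measurable
  have lim: "AE x in lebesgue. (\<lambda>i. f (r i) x) \<longlonglongrightarrow> G x"
    using r(2)
  proof eventually_elim
    case (elim x)
    then obtain l where "(\<lambda>i. f (r i) x * w x) \<longlonglongrightarrow> l"
      by (auto simp: Cauchy_convergent_iff convergent_def)
    then have "(\<lambda>i. f (r i) x * w x / w x) \<longlonglongrightarrow> l / w x"
      using w(2)[of x] by (intro tendsto_divide) auto
    then have "convergent (\<lambda>i. f (r i) x)" using w(2)[of x] by (auto simp: convergent_def)
    then show ?case unfolding G_def by (simp add: convergent_LIMSEQ_iff)
  qed
  have key: "L2 lebesgue (\<lambda>x. f n x - G x) \<and> (\<integral>x. (f n x - G x)\<^sup>2 \<partial>lebesgue) \<le> e"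
    if N: "\<forall>i\<ge>N. \<forall>j\<ge>N. (\<integral>x. (f i x - f j x)\<^sup>2 \<partial>lebesgue) < e" and n: "n \<ge> N" for N n e
  proof -
    \<comment> \<open>Discarding the first N members of the subsequence keeps every index inside the
      range of the Cauchy bound.\<close>
    have r': "r (k + N) \<ge> N" for k
      using seq_suble[OF r(1), of "k + N"] by simp
    have F1: "L2 lebesgue (\<lambda>x. f n x - f (r (k + N)) x)" for k
      by (intro L2_diff f)
    have F2: "(\<integral>x. (f n x - f (r (k + N)) x)\<^sup>2 \<partial>lebesgue) \<le> e" for k
      using N n r'[of k] by (intro less_imp_le) blast
    have F3: "(\<lambda>x. f n x - G x) \<in> borel_measurable lebesgue"
      by (intro borel_measurable_diff) measurable
    have F4: "AE x in lebesgue. (\<lambda>k. f n x - f (r (k + N)) x) \<longlonglongrightarrow> f n x - G x"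
      using lim by eventually_elim (intro tendsto_diff tendsto_const LIMSEQ_ignore_initial_segment)
    show ?thesis
      using L2_Fatou[OF F1 F2 tendsto_const F3 F4] by blast
  qed
  obtain N where "\<forall>i\<ge>N. \<forall>j\<ge>N. (\<integral>x. (f i x - f j x)\<^sup>2 \<partial>lebesgue) < 1" using cau[of 1] by auto
  from L2_diff[OF f[of N] conjunct1[OF key[OF this order_refl]]] have "L2 lebesgue G" by simp
  moreover have "(\<lambda>n. \<integral>x. (f n x - G x)\<^sup>2 \<partial>lebesgue) \<longlonglongrightarrow> 0"
  proof (rule LIMSEQ_I)
    fix e :: real assume e: "e > 0"
    obtain N where N: "\<forall>i\<ge>N. \<forall>j\<ge>N. (\<integral>x. (f i x - f j x)\<^sup>2 \<partial>lebesgue) < e/2" using cau[of "e/2"] e by auto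
    show "\<exists>N. \<forall>n\<ge>N. norm ((\<integral>x. (f n x - G x)\<^sup>2 \<partial>lebesgue) - 0) < e"
      using key[OF N] e by (intro exI[of _ N]) fastforce
  qed
  ultimately show ?thesis using that by blast
qed

text \<open>A weak limit of a bounded sequence is obtained as the strong limit of elements of almost minimal
  norm in the convex hulls of its tails. Closing the tails under midpoints is enough for the
  parallelogram identity.\<close>

inductive_set tail_mid :: "(nat \<Rightarrow> 'a \<Rightarrow> real) \<Rightarrow> nat \<Rightarrow> ('a \<Rightarrow> real) set" for f n where
  base: "k \<ge> n \<Longrightarrow> f k \<in> tail_mid f n"
| mid: "h \<in> tail_mid f n \<Longrightarrow> k \<in> tail_mid f n \<Longrightarrow> (\<lambda>x. 1/2 * h x + 1/2 * k x) \<in> tail_mid f n"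

lemma tail_mid_mono: "h \<in> tail_mid f n \<Longrightarrow> m \<le> n \<Longrightarrow> h \<in> tail_mid f m"
  by (induction rule: tail_mid.induct) (blast intro: tail_mid.intros order_trans)+

lemma tail_mid_L2: "h \<in> tail_mid f n \<Longrightarrow> (\<And>k. L2 M (f k)) \<Longrightarrow> L2 M h"
  by (induction rule: tail_mid.induct) (blast intro: L2_lincomb)+

text \<open>Pairing to within e of l is a convex condition on the paired function, so it passes from
  the members of a tail to their iterated midpoints.\<close>

lemma tail_mid_weak:
  assumes "h \<in> tail_mid f n" "\<And>k. L2 M (f k)" "L2 M \<phi>"
    and "\<And>k. k \<ge> n \<Longrightarrow> \<bar>(\<integral>x. f k x * \<phi> x \<partial>M) - l\<bar> \<le> e"
  shows "\<bar>(\<integral>x. h x * \<phi> x \<partial>M) - l\<bar> \<le> e"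
  using assms(1)
proof (induction rule: tail_mid.induct)
  case (base k)
  then show ?case using assms by blast
next
  case (mid h k)
  have "(1/2 * h x + 1/2 * k x) * \<phi> x = 1/2 * (h x * \<phi> x) + 1/2 * (k x * \<phi> x)" for x
    by (simp add: algebra_simps)
  then have "(\<integral>x. (1/2 * h x + 1/2 * k x) * \<phi> x \<partial>M)
      = 1/2 * (\<integral>x. h x * \<phi> x \<partial>M) + 1/2 * (\<integral>x. k x * \<phi> x \<partial>M)"
    using L2_mult[OF tail_mid_L2[OF mid.hyps(1) assms(2)] assms(3)]
      L2_mult[OF tail_mid_L2[OF mid.hyps(2) assms(2)] assms(3)] by simp
  then show ?case using mid.IH by linarith
qed

text \<open>A conditional form of weak compactness: \<open>G\<close> has the right pairing with
  every function for which the pairings already converge. Difference quotients converge against test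
  functions, so no weakly convergent subsequence has to be extracted.\<close>

theorem L2_bounded_weak_limit:
  fixes f :: "nat \<Rightarrow> 'a::euclidean_space \<Rightarrow> real"
  assumes f: "\<And>n. L2 lebesgue (f n)" and bd: "\<And>n. (\<integral>x. (f n x)\<^sup>2 \<partial>lebesgue) \<le> C"
  shows "\<exists>G. L2 lebesgue G \<and> (\<forall>\<phi> l. L2 lebesgue \<phi> \<longrightarrow>
    (\<lambda>n. \<integral>x. f n x * \<phi> x \<partial>lebesgue) \<longlonglongrightarrow> l \<longrightarrow> (\<integral>x. G x * \<phi> x \<partial>lebesgue) = l)"
proof -
  define nrm where "nrm h = (\<integral>x. (h x)\<^sup>2 \<partial>lebesgue)" for h :: "'a \<Rightarrow> real"
  have nrm0: "nrm h \<ge> 0" for h by (simp add: nrm_def)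
  define d where "d n = Inf (nrm ` tail_mid f n)" for n
  have bb: "bdd_below (nrm ` tail_mid f n)" for n using nrm0 by (intro bdd_belowI2) auto
  have d_le: "d n \<le> nrm h" if "h \<in> tail_mid f n" for n h
    unfolding d_def by (rule cINF_lower[OF bb that])
  have ne: "nrm ` tail_mid f n \<noteq> {}" for n using tail_mid.base[of n n f] by auto
  \<comment> \<open>The tails shrink, so the infima increase; being bounded by \<open>C\<close> they
    converge, and this makes the almost minimal elements a Cauchy sequence.\<close>
  have d_inc: "d m \<le> d n" if "m \<le> n" for m n
    unfolding d_def
    by (rule cInf_superset_mono[OF ne bb]) (use that tail_mid_mono in blast)
  have d_C: "d n \<le> C" for n
    using d_le[OF tail_mid.base[of n n f]] bd[of n] by (simp add: nrm_def)
  obtain D where "d \<longlonglongrightarrow> D"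
    using incseq_convergent[of d C] d_inc d_C unfolding incseq_def by metis
  then have cauchy_d: "Cauchy d" by (rule LIMSEQ_imp_Cauchy)
  have "\<exists>h. h \<in> tail_mid f n \<and> nrm h < d n + inverse (real (Suc n))" for n
  proof -
    have "Inf (nrm ` tail_mid f n) < d n + inverse (real (Suc n))"
      by (simp add: d_def[symmetric])
    then show ?thesis using cInf_lessD[OF ne] by blast
  qed
  then obtain h where h: "\<And>n. h n \<in> tail_mid f n" "\<And>n. nrm (h n) < d n + inverse (real (Suc n))" by metis
  have hL: "L2 lebesgue (h n)" for n using tail_mid_L2[OF h(1) f] .
  \<comment> \<open>The parallelogram identity gives 2 |h_i|^2 + 2 |h_j|^2 - 4 |midpoint|^2. The
    midpoint lies in the i-th tail, so its squared norm is at least \<open>d i\<close>. The two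
    excesses over the infima are each at most the one at i.\<close>
  have par: "(\<integral>x. (h i x - h j x)\<^sup>2 \<partial>lebesgue) \<le> 2 * (d j - d i) + 4 * inverse (real (Suc i))" if "i \<le> j" for i j
  proof -
    have m: "(\<lambda>x. 1/2 * h i x + 1/2 * h j x) \<in> tail_mid f i"
      using h(1)[of i] tail_mid_mono[OF h(1)[of j] that] by (rule tail_mid.mid)
    have 1: "d i \<le> 1/4 * nrm (h i) + 1/2 * (\<integral>x. h i x * h j x \<partial>lebesgue) + 1/4 * nrm (h j)"
      using d_le[OF m] L2_integral_lincomb[OF hL hL, of "1/2" i "1/2" j]
      by (simp add: nrm_def power2_eq_square)
    have 2: "(\<integral>x. (h i x - h j x)\<^sup>2 \<partial>lebesgue) = nrm (h i) - 2 * (\<integral>x. h i x * h j x \<partial>lebesgue) + nrm (h j)"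
      using L2_integral_lincomb[OF hL hL, of "1" i "-1" j] by (simp add: nrm_def)
    define P ei ej where "P = (\<integral>x. h i x * h j x \<partial>lebesgue)"
      and "ei = inverse (real (Suc i))" and "ej = inverse (real (Suc j))"
    have "ej \<le> ei" using that by (simp add: ei_def ej_def)
    then show ?thesis
      using 1 h(2)[of i] h(2)[of j]
      unfolding 2 P_def[symmetric] ei_def[symmetric] ej_def[symmetric] by argo
  qed
  have cau: "\<exists>N. \<forall>i\<ge>N. \<forall>j\<ge>N. (\<integral>x. (h i x - h j x)\<^sup>2 \<partial>lebesgue) < e" if e: "e > 0" for e
  proof -
    \<comment> \<open>The thresholds e/4 here and e/8 next match the coefficients 2 and 4 in
      \<open>par\<close>.\<close>
    obtain N1 where N1: "\<And>i j. i \<ge> N1 \<Longrightarrow> j \<ge> N1 \<Longrightarrow> \<bar>d i - d j\<bar> < e / 4"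
      using cauchy_d[unfolded Cauchy_def, rule_format, of "e/4"] e by (auto simp: dist_real_def)
    obtain N2 where N2: "inverse (real (Suc N2)) < e / 8"
      using reals_Archimedean[of "e/8"] e by auto
    have *: "(\<integral>x. (h i x - h j x)\<^sup>2 \<partial>lebesgue) < e" if "i \<ge> max N1 N2" "i \<le> j" for i j
    proof -
      have "inverse (real (Suc i)) \<le> inverse (real (Suc N2))" using that by simp
      then have "inverse (real (Suc i)) < e / 8" using N2 by (rule le_less_trans)
      moreover have "\<bar>d j - d i\<bar> < e / 4" using N1[of j i] that by auto
      then have "d j - d i < e / 4" by (rule le_less_trans[OF abs_ge_self])
      ultimately show ?thesis using par[OF that(2)] by argo
    qed
    have "(\<integral>x. (h i x - h j x)\<^sup>2 \<partial>lebesgue) < e" if "i \<ge> max N1 N2" "j \<ge> max N1 N2" for i j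
    proof (cases "i \<le> j")
      case True
      then show ?thesis using * that by blast
    next
      case False
      then show ?thesis using *[of j i] that by (simp add: power2_commute)
    qed
    then show ?thesis by blast
  qed
  obtain G where G: "L2 lebesgue G" "(\<lambda>n. \<integral>x. (h n x - G x)\<^sup>2 \<partial>lebesgue) \<longlonglongrightarrow> 0"
    using L2_complete[OF hL cau] by blast
  have "(\<integral>x. G x * \<phi> x \<partial>lebesgue) = l"
    if \<phi>: "L2 lebesgue \<phi>" and l: "(\<lambda>n. \<integral>x. f n x * \<phi> x \<partial>lebesgue) \<longlonglongrightarrow> l" for \<phi> l
  proof -
    have "(\<lambda>n. \<integral>x. h n x * \<phi> x \<partial>lebesgue) \<longlonglongrightarrow> l"
    proof (rule LIMSEQ_I)
      fix e :: real assume e: "e > 0"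
      obtain N where N: "\<And>k. k \<ge> N \<Longrightarrow> \<bar>(\<integral>x. f k x * \<phi> x \<partial>lebesgue) - l\<bar> < e / 2"
        using LIMSEQ_D[OF l, of "e/2"] e by auto
      have "\<bar>(\<integral>x. h n x * \<phi> x \<partial>lebesgue) - l\<bar> \<le> e / 2" if "n \<ge> N" for n
        by (rule tail_mid_weak[OF h(1) f \<phi>]) (use N that in \<open>meson less_imp_le order_trans\<close>)
      then show "\<exists>N. \<forall>n\<ge>N. norm ((\<integral>x. h n x * \<phi> x \<partial>lebesgue) - l) < e"
        using e by (intro exI[of _ N]) force
    qed
    moreover have "(\<lambda>n. \<integral>x. h n x * \<phi> x \<partial>lebesgue) \<longlonglongrightarrow> (\<integral>x. G x * \<phi> x \<partial>lebesgue)"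
    proof -
      have "(\<lambda>n. ((\<integral>x. h n x * \<phi> x \<partial>lebesgue) - (\<integral>x. G x * \<phi> x \<partial>lebesgue))\<^sup>2) \<longlonglongrightarrow> 0"
      proof (rule tendsto_sandwich[OF _ _ tendsto_const])
        show "\<forall>\<^sub>F n in sequentially. ((\<integral>x. h n x * \<phi> x \<partial>lebesgue) - (\<integral>x. G x * \<phi> x \<partial>lebesgue))\<^sup>2
            \<le> (\<integral>x. (h n x - G x)\<^sup>2 \<partial>lebesgue) * (\<integral>x. (\<phi> x)\<^sup>2 \<partial>lebesgue)"
        proof (intro always_eventually allI)
          fix n
          have "(\<integral>x. h n x * \<phi> x \<partial>lebesgue) - (\<integral>x. G x * \<phi> x \<partial>lebesgue) = (\<integral>x. (h n x - G x) * \<phi> x \<partial>lebesgue)"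
            using L2_mult[OF hL \<phi>, of n] L2_mult[OF G(1) \<phi>] by (simp add: left_diff_distrib)
          then show "((\<integral>x. h n x * \<phi> x \<partial>lebesgue) - (\<integral>x. G x * \<phi> x \<partial>lebesgue))\<^sup>2
            \<le> (\<integral>x. (h n x - G x)\<^sup>2 \<partial>lebesgue) * (\<integral>x. (\<phi> x)\<^sup>2 \<partial>lebesgue)"
            using L2_Cauchy_Schwarz[OF L2_diff[OF hL G(1)] \<phi>, of n] by simp
        qed
        show "(\<lambda>n. (\<integral>x. (h n x - G x)\<^sup>2 \<partial>lebesgue) * (\<integral>x. (\<phi> x)\<^sup>2 \<partial>lebesgue)) \<longlonglongrightarrow> 0"
          using tendsto_mult[OF G(2) tendsto_const[of "\<integral>x. (\<phi> x)\<^sup>2 \<partial>lebesgue"]] by simp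
      qed auto
      then have "(\<lambda>n. (\<integral>x. h n x * \<phi> x \<partial>lebesgue) - (\<integral>x. G x * \<phi> x \<partial>lebesgue)) \<longlonglongrightarrow> 0"
        using tendsto_real_sqrt[of _ 0] by (fastforce simp: tendsto_rabs_zero_iff)
      then show ?thesis by (simp add: LIM_zero_iff)
    qed
    ultimately show ?thesis using LIMSEQ_unique by blast
  qed
  with G(1) show ?thesis by blast
qed

section \<open>Difference quotients\<close>

lemma L2_lebesgue_local:
  assumes "L2 lebesgue f"
  shows "L1_loc f" "L2_loc f"
proof -
  have [measurable]: "f \<in> borel_measurable lebesgue" using assms by (simp add: L2_def)
  show "L1_loc f"
    unfolding L1_loc_def
  proof (intro conjI allI impI)
    fix K :: "'a set" assume K: "compact K"
    then have "K \<in> lmeasurable" by (rule lmeasurable_compact)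
    then have "integrable lebesgue (indicator K :: 'a \<Rightarrow> real)"
      by (intro integrable_real_indicator) (auto simp: fmeasurable_def)
    moreover have "(\<lambda>x. (indicator K x :: real)\<^sup>2) = indicator K"
      by (auto simp: indicator_def)
    ultimately have "L2 lebesgue (indicator K :: 'a \<Rightarrow> real)"
      unfolding L2_def by (auto dest: borel_measurable_integrable)
    from L2_mult[OF this assms] show "set_integrable lebesgue K f"
      by (simp add: set_integrable_def)
  qed simp
  show "L2_loc f"
    unfolding L2_loc_def set_integrable_def
  proof (intro conjI allI impI)
    fix K :: "'a set" assume "compact K"
    then have "K \<in> sets lebesgue" by (simp add: borel_compact)
    then show "integrable lebesgue (\<lambda>x. indicator K x *\<^sub>R (f x)\<^sup>2)"
      using assms by (intro integrable_mult_indicator) (auto simp: L2_def)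
  qed simp
qed

text \<open>The two bounds together dominate all difference quotients with steps of size at most 1
  by a constant on one fixed ball, which is what dominated convergence needs.\<close>

lemma test_fun_increment:
  assumes "test_fun \<phi>" "b \<in> Basis"
  obtains B R where "B > 0" "\<And>x t. \<bar>\<phi> (x + t *\<^sub>R b) - \<phi> x\<bar> \<le> B * \<bar>t\<bar>"
    "\<And>x t. \<bar>t\<bar> \<le> 1 \<Longrightarrow> norm x > R \<Longrightarrow> \<phi> (x + t *\<^sub>R b) - \<phi> x = 0"
proof -
  have sm: "smooth_fun \<phi>" using assms by (simp add: test_fun_def)
  obtain R where R: "R > 0" "\<And>x. norm x > R \<Longrightarrow> \<phi> x = 0" "\<And>x b. norm x > R \<Longrightarrow> partial b \<phi> x = 0"
    using test_fun_support[OF assms(1)] by metis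
  obtain B where B: "B > 0" "\<And>x. \<bar>partial b \<phi> x\<bar> \<le> B"
    using compact_support_bounded[OF partial_continuous[OF sm assms(2)], of R] R(3) by metis
  have "\<bar>\<phi> (x + t *\<^sub>R b) - \<phi> x\<bar> \<le> B * \<bar>t\<bar>" for x t
    using field_differentiable_bound[of UNIV "\<lambda>s. \<phi> (x + s *\<^sub>R b)" "\<lambda>s. partial b \<phi> (x + s *\<^sub>R b)" B t 0]
      partial_line[OF sm] B(2) by simp
  \<comment> \<open>A step of size at most 1 along a unit vector can re-enter the ball of radius R
    only from within radius R + 1.\<close>
  moreover have "\<phi> (x + t *\<^sub>R b) - \<phi> x = 0" if "\<bar>t\<bar> \<le> 1" "norm x > R + 1" for x t
  proof -
    have "norm x \<le> norm (x + t *\<^sub>R b) + norm (t *\<^sub>R b)"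
      using norm_triangle_ineq4[of "x + t *\<^sub>R b" "t *\<^sub>R b"] by simp
    then have "norm (x + t *\<^sub>R b) > R" using that assms(2) by simp
    then show ?thesis using R(2)[of x] R(2)[of "x + t *\<^sub>R b"] that(2) by simp
  qed
  ultimately show ?thesis using that B(1) by blast
qed

lemma test_fun_quotient_tendsto:
  assumes "test_fun \<phi>" and s: "s \<longlonglongrightarrow> 0" "\<And>n. s n \<noteq> 0"
  shows "(\<lambda>n. (\<phi> (x + s n *\<^sub>R b) - \<phi> x) / s n) \<longlonglongrightarrow> partial b \<phi> x"
proof -
  have "smooth_fun \<phi>" using assms by (simp add: test_fun_def)
  from partial_line[OF this, of x b 0]
  have "((\<lambda>h. (\<phi> (x + h *\<^sub>R b) - \<phi> x) / h) \<longlongrightarrow> partial b \<phi> x) (at 0)"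
    by (simp add: DERIV_def)
  moreover have "filterlim s (at 0) sequentially"
    using s by (simp add: filterlim_at)
  ultimately show ?thesis by (rule filterlim_compose)
qed

lemma test_fun_measurable [measurable]:
  "test_fun \<phi> \<Longrightarrow> \<phi> \<in> borel_measurable lebesgue"
  by (auto simp: test_fun_def intro: continuous_borel_lebesgue smooth_fun_continuous)

lemma test_fun_partial_measurable:
  "test_fun \<phi> \<Longrightarrow> b \<in> Basis \<Longrightarrow> partial b \<phi> \<in> borel_measurable lebesgue"
  by (auto simp: test_fun_def intro: continuous_borel_lebesgue partial_continuous)

lemma test_fun_L2:
  assumes "test_fun \<phi>"
  shows "L2 lebesgue \<phi>" "b \<in> Basis \<Longrightarrow> L2 lebesgue (partial b \<phi>)"
proof -
  have sm: "smooth_fun \<phi>" using assms by (simp add: test_fun_def)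
  obtain R where R: "R > 0" "\<And>x. norm x > R \<Longrightarrow> \<phi> x = 0" "\<And>x b. norm x > R \<Longrightarrow> partial b \<phi> x = 0"
    using test_fun_support[OF assms(1)] by metis
  have "integrable lebesgue (\<lambda>x. (\<phi> x)\<^sup>2)"
    by (rule integrable_compact_support[where R=R])
       (use R smooth_fun_continuous[OF sm] in \<open>auto intro!: continuous_intros\<close>)
  then show "L2 lebesgue \<phi>" using test_fun_measurable[OF assms] by (simp add: L2_def)
  assume b: "b \<in> Basis"
  have "integrable lebesgue (\<lambda>x. (partial b \<phi> x)\<^sup>2)"
    by (rule integrable_compact_support[where R=R])
       (use R partial_continuous[OF sm b] in \<open>auto intro!: continuous_intros\<close>)
  then show "L2 lebesgue (partial b \<phi>)" using test_fun_partial_measurable[OF assms b] by (simp add: L2_def)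
qed

lemma L1_loc_quotient_tendsto:
  assumes f: "L1_loc f" and \<phi>: "test_fun \<phi>" and b: "b \<in> Basis"
    and s: "s \<longlonglongrightarrow> 0" "\<And>n. s n \<noteq> 0" "\<And>n. \<bar>s n\<bar> \<le> 1"
  shows "(\<lambda>n. \<integral>x. f x * ((\<phi> (x + s n *\<^sub>R b) - \<phi> x) / s n) \<partial>lebesgue)
      \<longlonglongrightarrow> (\<integral>x. f x * partial b \<phi> x \<partial>lebesgue)"
proof -
  obtain B R where B: "B > 0" "\<And>x t. \<bar>\<phi> (x + t *\<^sub>R b) - \<phi> x\<bar> \<le> B * \<bar>t\<bar>"
    and R: "\<And>x t. \<bar>t\<bar> \<le> 1 \<Longrightarrow> norm x > R \<Longrightarrow> \<phi> (x + t *\<^sub>R b) - \<phi> x = 0"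
    using test_fun_increment[OF \<phi> b] by metis
  have fm: "f \<in> borel_measurable lebesgue" using f by (simp add: L1_loc_def)
  show ?thesis
  proof (rule integral_dominated_convergence)
    show "integrable lebesgue (\<lambda>x. B * norm (indicator (cball 0 R) x *\<^sub>R f x))"
      using f by (intro integrable_mult_right integrable_norm) (auto simp: L1_loc_def set_integrable_def)
    show "AE x in lebesgue. (\<lambda>n. f x * ((\<phi> (x + s n *\<^sub>R b) - \<phi> x) / s n)) \<longlonglongrightarrow> f x * partial b \<phi> x"
      by (intro AE_I2 tendsto_mult tendsto_const test_fun_quotient_tendsto \<phi> s)
    show "AE x in lebesgue. norm (f x * ((\<phi> (x + s n *\<^sub>R b) - \<phi> x) / s n))
        \<le> B * norm (indicator (cball 0 R) x *\<^sub>R f x)" for n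
    proof (rule AE_I2)
      fix x
      have "\<bar>(\<phi> (x + s n *\<^sub>R b) - \<phi> x) / s n\<bar> \<le> B"
        using B(2)[of x "s n"] s(2)[of n] by (simp add: divide_le_eq)
      then show "norm (f x * ((\<phi> (x + s n *\<^sub>R b) - \<phi> x) / s n)) \<le> B * norm (indicator (cball 0 R) x *\<^sub>R f x)"
        using R[OF s(3)[of n], of x]
        by (cases "norm x \<le> R") (auto simp: abs_mult mult.commute[of B] intro!: mult_left_mono simp del: abs_divide times_divide_eq_right)
    qed
    show "(\<lambda>x. f x * partial b \<phi> x) \<in> borel_measurable lebesgue"
      by (intro borel_measurable_times fm test_fun_partial_measurable \<phi> b)
    show "(\<lambda>x. f x * ((\<phi> (x + s n *\<^sub>R b) - \<phi> x) / s n)) \<in> borel_measurable lebesgue" for n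
      by (intro borel_measurable_times borel_measurable_divide borel_measurable_diff borel_measurable_const
          fm test_fun_measurable test_fun_shift \<phi>)
  qed
qed

lemma test_fun_quotient_square_tendsto:
  fixes \<phi> :: "'a::euclidean_space \<Rightarrow> real"
  assumes \<phi>: "test_fun \<phi>" and b: "b \<in> Basis"
    and s: "s \<longlonglongrightarrow> 0" "\<And>n. s n \<noteq> 0" "\<And>n. \<bar>s n\<bar> \<le> 1"
  shows "(\<lambda>n. \<integral>x. ((\<phi> (x + s n *\<^sub>R b) - \<phi> x) / s n)\<^sup>2 \<partial>lebesgue)
      \<longlonglongrightarrow> (\<integral>x. (partial b \<phi> x)\<^sup>2 \<partial>lebesgue)"
proof -
  obtain B R where B: "B > 0" "\<And>x t. \<bar>\<phi> (x + t *\<^sub>R b) - \<phi> x\<bar> \<le> B * \<bar>t\<bar>"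
    and R: "\<And>x t. \<bar>t\<bar> \<le> 1 \<Longrightarrow> norm x > R \<Longrightarrow> \<phi> (x + t *\<^sub>R b) - \<phi> x = 0"
    using test_fun_increment[OF \<phi> b] by metis
  show ?thesis
  proof (rule integral_dominated_convergence)
    have "integrable lebesgue (indicator (cball 0 R) :: 'a \<Rightarrow> real)"
      using lmeasurable_cball[of 0 R] by (intro integrable_real_indicator) (auto simp: fmeasurable_def)
    then show "integrable lebesgue (\<lambda>x::'a. B\<^sup>2 * indicator (cball 0 R) x)"
      by (rule integrable_mult_right)
    show "AE x in lebesgue. (\<lambda>n. ((\<phi> (x + s n *\<^sub>R b) - \<phi> x) / s n)\<^sup>2) \<longlonglongrightarrow> (partial b \<phi> x)\<^sup>2"
      by (intro AE_I2 tendsto_power test_fun_quotient_tendsto \<phi> s)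
    show "AE x in lebesgue. norm (((\<phi> (x + s n *\<^sub>R b) - \<phi> x) / s n)\<^sup>2) \<le> B\<^sup>2 * indicator (cball 0 R) x" for n
    proof (rule AE_I2)
      fix x
      have "\<bar>(\<phi> (x + s n *\<^sub>R b) - \<phi> x) / s n\<bar> \<le> B"
        using B(2)[of x "s n"] s(2)[of n] by (simp add: divide_le_eq)
      then have "((\<phi> (x + s n *\<^sub>R b) - \<phi> x) / s n)\<^sup>2 \<le> B\<^sup>2"
        using B(1) by (metis abs_le_square_iff abs_of_pos)
      then show "norm (((\<phi> (x + s n *\<^sub>R b) - \<phi> x) / s n)\<^sup>2) \<le> B\<^sup>2 * indicator (cball 0 R) x"
        using R[OF s(3)[of n], of x] by (cases "norm x \<le> R") simp_all
    qed
    show "(\<lambda>x. (partial b \<phi> x)\<^sup>2) \<in> borel_measurable lebesgue"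
      by (intro borel_measurable_power test_fun_partial_measurable \<phi> b)
    show "(\<lambda>x. ((\<phi> (x + s n *\<^sub>R b) - \<phi> x) / s n)\<^sup>2) \<in> borel_measurable lebesgue" for n
      by (intro borel_measurable_power borel_measurable_divide borel_measurable_diff borel_measurable_const
          test_fun_measurable test_fun_shift \<phi>)
  qed
qed

lemma L2_shift: "L2 lebesgue f \<Longrightarrow> L2 lebesgue (\<lambda>x. f (x + h))"
  unfolding L2_def by (auto intro: lebesgue_measurable_shift_fun lebesgue_integrable_shift)

text \<open>The quotients are bounded in L^2. Discrete integration by parts moves each one onto the
  test function, where it converges to the partial derivative; the weak limit is therefore the weak
  derivative.\<close>

theorem weak_derivative_of_quotients:
  fixes f :: "'a::euclidean_space \<Rightarrow> real"
  assumes f: "L2 lebesgue f" and b: "b \<in> Basis"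
    and s: "s \<longlonglongrightarrow> 0" "\<And>n. s n > 0" "\<And>n. s n \<le> 1"
    and bd: "\<And>n. (\<integral>x. (f (x + s n *\<^sub>R b) - f x)\<^sup>2 \<partial>lebesgue) \<le> C * (s n)\<^sup>2"
  shows "\<exists>G. L2 lebesgue G \<and> (\<forall>\<phi>. test_fun \<phi> \<longrightarrow>
    (\<integral>x. f x * partial b \<phi> x \<partial>lebesgue) = - (\<integral>x. G x * \<phi> x \<partial>lebesgue))"
proof -
  let ?q = "\<lambda>n x. 1 / s n * f (x + s n *\<^sub>R b) + (- 1 / s n) * f x"
  have q: "L2 lebesgue (?q n)" for n
    by (intro L2_lincomb L2_shift f)
  have q2: "(\<integral>x. (?q n x)\<^sup>2 \<partial>lebesgue) \<le> C" for n
  proof -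
    have "(?q n x)\<^sup>2 = (f (x + s n *\<^sub>R b) - f x)\<^sup>2 / (s n)\<^sup>2" for x
      using s(2)[of n] by (simp add: field_simps power2_eq_square)
    then have "(\<integral>x. (?q n x)\<^sup>2 \<partial>lebesgue) = (\<integral>x. (f (x + s n *\<^sub>R b) - f x)\<^sup>2 \<partial>lebesgue) / (s n)\<^sup>2"
      by simp
    also have "\<dots> \<le> C" using bd[of n] s(2)[of n] by (simp add: divide_le_eq)
    finally show ?thesis .
  qed
  obtain G where G: "L2 lebesgue G" "\<forall>\<phi> l. L2 lebesgue \<phi> \<longrightarrow>
      (\<lambda>n. \<integral>x. ?q n x * \<phi> x \<partial>lebesgue) \<longlonglongrightarrow> l \<longrightarrow> (\<integral>x. G x * \<phi> x \<partial>lebesgue) = l"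
    using L2_bounded_weak_limit[where f="?q" and C=C, OF q q2] by blast
  have "(\<integral>x. f x * partial b \<phi> x \<partial>lebesgue) = - (\<integral>x. G x * \<phi> x \<partial>lebesgue)" if \<phi>: "test_fun \<phi>" for \<phi>
  proof -
    have eq: "(\<integral>x. ?q n x * \<phi> x \<partial>lebesgue) = - (\<integral>x. f x * ((\<phi> (x + (- s n) *\<^sub>R b) - \<phi> x) / (- s n)) \<partial>lebesgue)" for n
    proof -
      let ?h = "s n *\<^sub>R b"
      have i1: "integrable lebesgue (\<lambda>x. f x * \<phi> (x + (- s n) *\<^sub>R b))"
        by (rule L2_mult[OF f L2_shift[OF test_fun_L2(1)[OF \<phi>]]])
      have i2: "integrable lebesgue (\<lambda>x. f x * \<phi> x)"
        by (rule L2_mult[OF f test_fun_L2(1)[OF \<phi>]])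
      have i3: "integrable lebesgue (\<lambda>x. f (x + ?h) * \<phi> x)"
        by (rule L2_mult[OF L2_shift[OF f] test_fun_L2(1)[OF \<phi>]])
      \<comment> \<open>Discrete integration by parts: a forward translation of \<open>f\<close>
        becomes a backward translation of the test function, whence the step - s n and the sign in
        \<open>eq\<close>.\<close>
      have tr: "(\<integral>x. f (x + ?h) * \<phi> x \<partial>lebesgue) = (\<integral>x. f x * \<phi> (x + (- s n) *\<^sub>R b) \<partial>lebesgue)"
        using lebesgue_integral_shift[OF borel_measurable_integrable[OF i1], of ?h] by simp
      have "(\<integral>x. ?q n x * \<phi> x \<partial>lebesgue)
          = (\<integral>x. 1 / s n * (f (x + ?h) * \<phi> x) - 1 / s n * (f x * \<phi> x) \<partial>lebesgue)"
        by (intro Bochner_Integration.integral_cong) (auto simp: algebra_simps diff_divide_distrib)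
      also have "\<dots> = 1 / s n * (\<integral>x. f (x + ?h) * \<phi> x \<partial>lebesgue) - 1 / s n * (\<integral>x. f x * \<phi> x \<partial>lebesgue)"
        using i2 i3 by simp
      also have "\<dots> = (\<integral>x. 1 / s n * (f x * \<phi> (x + (- s n) *\<^sub>R b)) - 1 / s n * (f x * \<phi> x) \<partial>lebesgue)"
        unfolding tr using i1 i2 by simp
      also have "\<dots> = (\<integral>x. - (f x * ((\<phi> (x + (- s n) *\<^sub>R b) - \<phi> x) / (- s n))) \<partial>lebesgue)"
        by (intro Bochner_Integration.integral_cong) (auto simp: algebra_simps diff_divide_distrib)
      finally show ?thesis by simp
    qed
    have "(\<lambda>n. \<integral>x. f x * ((\<phi> (x + (- s n) *\<^sub>R b) - \<phi> x) / (- s n)) \<partial>lebesgue)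
        \<longlonglongrightarrow> (\<integral>x. f x * partial b \<phi> x \<partial>lebesgue)"
    proof (rule L1_loc_quotient_tendsto[OF L2_lebesgue_local(1)[OF f] \<phi> b])
      show "(\<lambda>n. - s n) \<longlonglongrightarrow> 0" using tendsto_minus[OF s(1)] by simp
      show "- s n \<noteq> 0" "\<bar>- s n\<bar> \<le> 1" for n using s(2,3)[of n] by auto
    qed
    then have "(\<lambda>n. \<integral>x. ?q n x * \<phi> x \<partial>lebesgue) \<longlonglongrightarrow> - (\<integral>x. f x * partial b \<phi> x \<partial>lebesgue)"
      unfolding eq by (rule tendsto_minus)
    from G(2)[rule_format, OF test_fun_L2(1)[OF \<phi>] this] show ?thesis by simp
  qed
  with G(1) show ?thesis by blast
qed

text \<open>Splitting an increment into many small ones reduces this estimate to the limit of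
  difference quotients.\<close>

lemma test_fun_increment_L2:
  fixes \<phi> :: "'a::euclidean_space \<Rightarrow> real"
  assumes \<phi>: "test_fun \<phi>" and b: "b \<in> Basis" and t: "t \<noteq> 0" "\<bar>t\<bar> \<le> 1"
  shows "(\<integral>x. (\<phi> (x + t *\<^sub>R b) - \<phi> x)\<^sup>2 \<partial>lebesgue) \<le> t\<^sup>2 * (\<integral>x. (partial b \<phi> x)\<^sup>2 \<partial>lebesgue)"
proof -
  define s where "s n = t * inverse (real (Suc n))" for n
  have s0: "s \<longlonglongrightarrow> 0"
    unfolding s_def[abs_def] using tendsto_mult[OF tendsto_const[of t] LIMSEQ_inverse_real_of_nat] by simp
  have sn: "s n \<noteq> 0" for n using t by (simp add: s_def)
  have s1: "\<bar>s n\<bar> \<le> 1" for n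
  proof -
    have "\<bar>s n\<bar> = \<bar>t\<bar> * inverse (real (Suc n))" by (simp add: s_def abs_mult)
    also have "\<dots> \<le> 1 * 1" using t by (intro mult_mono) (auto simp: inverse_le_1_iff)
    finally show ?thesis by simp
  qed
  have bound: "(\<integral>x. (\<phi> (x + t *\<^sub>R b) - \<phi> x)\<^sup>2 \<partial>lebesgue)
      \<le> t\<^sup>2 * (\<integral>x. ((\<phi> (x + s n *\<^sub>R b) - \<phi> x) / s n)\<^sup>2 \<partial>lebesgue)" for n
  proof -
    let ?m = "Suc n" and ?\<psi> = "\<lambda>x. \<phi> (x + s n *\<^sub>R b) - \<phi> x"
    have \<psi>: "L2 lebesgue ?\<psi>"
      by (intro L2_diff L2_shift test_fun_L2(1)[OF \<phi>])
    have ms: "real ?m * s n = t" by (simp add: s_def field_simps)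
    have tel: "\<phi> (x + t *\<^sub>R b) - \<phi> x = (\<Sum>k<?m. ?\<psi> (x + (real k * s n) *\<^sub>R b))" for x
    proof -
      have "(\<Sum>k<?m. ?\<psi> (x + (real k * s n) *\<^sub>R b))
          = (\<Sum>k<?m. \<phi> (x + (real (Suc k) * s n) *\<^sub>R b) - \<phi> (x + (real k * s n) *\<^sub>R b))"
        by (intro sum.cong) (auto simp: algebra_simps)
      also have "\<dots> = \<phi> (x + (real ?m * s n) *\<^sub>R b) - \<phi> x"
        using sum_lessThan_telescope[of "\<lambda>k. \<phi> (x + (real k * s n) *\<^sub>R b)" ?m] by simp
      finally show ?thesis by (simp only: ms)
    qed
    have sh: "L2 lebesgue (\<lambda>x. ?\<psi> (x + (real k * s n) *\<^sub>R b))" for k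
      by (rule L2_shift[OF \<psi>])
    have "(\<integral>x. (\<phi> (x + t *\<^sub>R b) - \<phi> x)\<^sup>2 \<partial>lebesgue)
        \<le> (\<integral>x. (\<Sum>k<?m. (?\<psi> (x + (real k * s n) *\<^sub>R b))\<^sup>2) * real ?m \<partial>lebesgue)"
    proof (rule integral_mono)
      show "integrable lebesgue (\<lambda>x. (\<phi> (x + t *\<^sub>R b) - \<phi> x)\<^sup>2)"
        using L2_diff[OF L2_shift[OF test_fun_L2(1)[OF \<phi>]] test_fun_L2(1)[OF \<phi>]] by (simp add: L2_def)
      show "integrable lebesgue (\<lambda>x. (\<Sum>k<?m. (?\<psi> (x + (real k * s n) *\<^sub>R b))\<^sup>2) * real ?m)"
        using sh unfolding L2_def by (intro integrable_mult_left Bochner_Integration.integrable_sum) blast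
      show "(\<phi> (x + t *\<^sub>R b) - \<phi> x)\<^sup>2 \<le> (\<Sum>k<?m. (?\<psi> (x + (real k * s n) *\<^sub>R b))\<^sup>2) * real ?m" for x
        unfolding tel
        using sum_squared_le_sum_of_squares[of "\<lambda>k. ?\<psi> (x + (real k * s n) *\<^sub>R b)" "{..<?m}"]
        by (simp only: card_lessThan finite_lessThan)
    qed
    also have "\<dots> = (\<Sum>k<?m. \<integral>x. (?\<psi> (x + (real k * s n) *\<^sub>R b))\<^sup>2 \<partial>lebesgue) * real ?m"
      using sh unfolding L2_def by (subst integral_mult_left_zero, subst Bochner_Integration.integral_sum) auto
    also have "\<dots> = (\<Sum>k<?m. \<integral>x. (?\<psi> x)\<^sup>2 \<partial>lebesgue) * real ?m"
    proof -
      have "(\<integral>x. (?\<psi> (x + (real k * s n) *\<^sub>R b))\<^sup>2 \<partial>lebesgue) = (\<integral>x. (?\<psi> x)\<^sup>2 \<partial>lebesgue)" for k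
        by (rule lebesgue_integral_shift[where f="\<lambda>x. (?\<psi> x)\<^sup>2"]) (use \<psi> in \<open>simp add: L2_def borel_measurable_integrable\<close>)
      then show ?thesis by (simp only:)
    qed
    \<comment> \<open>One factor m comes from Cauchy-Schwarz for a sum of m terms, the other from m
      equal integrals. Since m s = t, the product m^2 is t^2 / s^2.\<close>
    also have "\<dots> = (real ?m)\<^sup>2 * (\<integral>x. (?\<psi> x)\<^sup>2 \<partial>lebesgue)"
      by (simp add: power2_eq_square)
    also have "\<dots> = t\<^sup>2 * ((\<integral>x. (?\<psi> x)\<^sup>2 \<partial>lebesgue) / (s n)\<^sup>2)"
      unfolding ms[symmetric] using sn[of n] by (simp add: power_mult_distrib)
    also have "\<dots> = t\<^sup>2 * (\<integral>x. (?\<psi> x / s n)\<^sup>2 \<partial>lebesgue)"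
      by (simp add: power_divide)
    finally show ?thesis .
  qed
  have "(\<lambda>n. t\<^sup>2 * (\<integral>x. ((\<phi> (x + s n *\<^sub>R b) - \<phi> x) / s n)\<^sup>2 \<partial>lebesgue))
      \<longlonglongrightarrow> t\<^sup>2 * (\<integral>x. (partial b \<phi> x)\<^sup>2 \<partial>lebesgue)"
    by (intro tendsto_mult tendsto_const test_fun_quotient_square_tendsto \<phi> b s0 sn s1)
  then show ?thesis
    using bound by (intro LIMSEQ_le_const) auto
qed

section \<open>The energy space\<close>

text \<open>\<open>D12\<close> with its witnesses exposed, so that the gradient and the approximants
  can be translated and averaged along with the function.\<close>

definition D12_approx :: "('a::euclidean_space \<Rightarrow> real) \<Rightarrow> ('a \<Rightarrow> 'a) \<Rightarrow> (nat \<Rightarrow> 'a \<Rightarrow> real) \<Rightarrow> bool" where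
  "D12_approx u g \<phi> \<longleftrightarrow> has_weak_gradient u g \<and> L2 lebesgue (\<lambda>x. norm (g x)) \<and> (\<forall>k. test_fun (\<phi> k)) \<and>
     (\<lambda>k. \<integral>x. (norm (grad_fun (\<phi> k) x - g x))\<^sup>2 \<partial>lebesgue) \<longlonglongrightarrow> 0 \<and>
     (\<forall>k. integrable lebesgue (\<lambda>x. (norm (grad_fun (\<phi> k) x - g x))\<^sup>2)) \<and>
     (\<forall>k. integrable lebesgue (\<lambda>x. \<bar>\<phi> k x - u x\<bar> powr crit_exp TYPE('a))) \<and>
     (\<lambda>k. \<integral>x. \<bar>\<phi> k x - u x\<bar> powr crit_exp TYPE('a) \<partial>lebesgue) \<longlonglongrightarrow> 0"

lemma has_weak_gradient_norm_measurable:
  "has_weak_gradient u g \<Longrightarrow> (\<lambda>x. norm (g x)) \<in> borel_measurable lebesgue"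
  by (rule measurable_compose[OF has_weak_gradient_measurable(2) borel_measurable_norm])

lemma D12_iff: "D12 u \<longleftrightarrow> (\<exists>g \<phi>. D12_approx u g \<phi>)"
proof -
  have "Lp 2 (\<lambda>x. norm (g x)) \<longleftrightarrow> L2 lebesgue (\<lambda>x. norm (g x))" for g :: "'a \<Rightarrow> 'a"
    by (simp add: Lp_def L2_def)
  then show ?thesis unfolding D12_def D12_approx_def by blast
qed

text \<open>Here \<open>E\<close> stands for an approximation error of u and \<open>F\<close> for
  that of its mean with a translate. It serves both errors in \<open>D12_approx\<close>: the
  gradient one and the one with the critical power.\<close>

lemma integral_tendsto_0_shifted_bound:
  fixes F E :: "nat \<Rightarrow> 'a::euclidean_space \<Rightarrow> real"
  assumes E: "\<And>k. integrable lebesgue (E k)" "(\<lambda>k. \<integral>x. E k x \<partial>lebesgue) \<longlonglongrightarrow> 0"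
    and F: "\<And>k. F k \<in> borel_measurable lebesgue" "\<And>k x. 0 \<le> F k x" "\<And>k x. F k x \<le> E k x + E k (x + h)"
  shows "integrable lebesgue (F k)" "(\<lambda>k. \<integral>x. F k x \<partial>lebesgue) \<longlonglongrightarrow> 0"
proof -
  have E': "integrable lebesgue (\<lambda>x. E k x + E k (x + h))" for k
    by (intro Bochner_Integration.integrable_add E lebesgue_integrable_shift)
  show int: "integrable lebesgue (F k)" for k
  proof (rule Bochner_Integration.integrable_bound[OF E'[of k] F(1)])
    show "AE x in lebesgue. norm (F k x) \<le> norm (E k x + E k (x + h))"
      using F(2,3)[of k] by (intro AE_I2) (simp add: order_trans[OF _ abs_ge_self])
  qed
  have le: "(\<integral>x. F k x \<partial>lebesgue) \<le> 2 * (\<integral>x. E k x \<partial>lebesgue)" for k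
  proof -
    have "(\<integral>x. F k x \<partial>lebesgue) \<le> (\<integral>x. E k x + E k (x + h) \<partial>lebesgue)"
      by (intro integral_mono int E' F)
    also have "\<dots> = 2 * (\<integral>x. E k x \<partial>lebesgue)"
      using E(1)[of k] lebesgue_integrable_shift[OF E(1)[of k], of h]
        lebesgue_integral_shift[OF borel_measurable_integrable[OF E(1)[of k]], of h] by simp
    finally show ?thesis .
  qed
  have lim: "(\<lambda>k. 2 * (\<integral>x. E k x \<partial>lebesgue)) \<longlonglongrightarrow> 0"
    using tendsto_mult[OF tendsto_const[of 2] E(2)] by simp
  have "0 \<le> (\<integral>x. F k x \<partial>lebesgue)" for k
    using F(2) by (intro Bochner_Integration.integral_nonneg)
  then show "(\<lambda>k. \<integral>x. F k x \<partial>lebesgue) \<longlonglongrightarrow> 0"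
    using le by (intro tendsto_sandwich[OF _ _ tendsto_const lim] always_eventually allI)
qed

text \<open>The mean is bounded by the larger modulus, whose power is one of the two summands;
  convexity of the power is avoided.\<close>

lemma powr_abs_mean_le:
  fixes a b p :: real
  assumes "p \<ge> 0"
  shows "\<bar>1/2 * a + 1/2 * b\<bar> powr p \<le> \<bar>a\<bar> powr p + \<bar>b\<bar> powr p"
proof -
  have "\<bar>1/2 * a + 1/2 * b\<bar> \<le> max \<bar>a\<bar> \<bar>b\<bar>" by linarith
  then have "\<bar>1/2 * a + 1/2 * b\<bar> powr p \<le> (max \<bar>a\<bar> \<bar>b\<bar>) powr p"
    using assms by (intro powr_mono2) auto
  also have "\<dots> \<le> \<bar>a\<bar> powr p + \<bar>b\<bar> powr p" by (auto simp: max_def)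
  finally show ?thesis .
qed

lemma norm_mean_square_le:
  fixes a b :: "'a::euclidean_space"
  shows "(norm ((1/2) *\<^sub>R a + (1/2) *\<^sub>R b))\<^sup>2 \<le> (norm a)\<^sup>2 + (norm b)\<^sup>2"
proof -
  have "norm ((1/2) *\<^sub>R a + (1/2) *\<^sub>R b) \<le> 1/2 * norm a + 1/2 * norm b"
    by (rule norm_triangle_le) simp
  then have "(norm ((1/2) *\<^sub>R a + (1/2) *\<^sub>R b))\<^sup>2 \<le> (1/2 * norm a + 1/2 * norm b)\<^sup>2"
    by (intro power_mono) auto
  also have "\<dots> \<le> (norm a)\<^sup>2 + (norm b)\<^sup>2"
    using sum_squares_bound[of "norm a" "norm b"] by (simp add: power2_sum power_divide field_simps)
       (smt (verit) zero_le_power2)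
  finally show ?thesis .
qed

lemma crit_exp_pos: "DIM('a::euclidean_space) \<ge> 3 \<Longrightarrow> crit_exp TYPE('a) > 1"
  by (simp add: crit_exp_def less_divide_eq)

text \<open>Averaging the approximants with their translates gives errors that are means of an old
  error and its translate, so they tend to 0 by translation invariance.\<close>

lemma D12_approx_mean:
  fixes u :: "'a::euclidean_space \<Rightarrow> real"
  assumes "D12_approx u g \<phi>" and dim: "DIM('a) \<ge> 3"
  shows "D12_approx (\<lambda>x. 1/2 * u x + 1/2 * u (x + h)) (\<lambda>x. (1/2) *\<^sub>R g x + (1/2) *\<^sub>R g (x + h))
    (\<lambda>k x. 1/2 * \<phi> k x + 1/2 * \<phi> k (x + h))"
proof -
  note A = assms(1)[unfolded D12_approx_def]
  let ?p = "crit_exp TYPE('a)"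
  let ?u = "\<lambda>x. 1/2 * u x + 1/2 * u (x + h)" and ?g = "\<lambda>x. (1/2) *\<^sub>R g x + (1/2) *\<^sub>R g (x + h)"
  let ?\<phi> = "\<lambda>k x. 1/2 * \<phi> k x + 1/2 * \<phi> k (x + h)"
  have wg: "has_weak_gradient ?u ?g"
    using A by (intro has_weak_gradient_lincomb has_weak_gradient_shift) auto
  have tf: "test_fun (\<phi> k)" for k using A by blast
  have tf': "test_fun (?\<phi> k)" for k
    by (intro test_fun_lincomb test_fun_shift tf)
  have sm: "smooth_fun (\<phi> k)" for k using tf[of k] by (simp add: test_fun_def)
  have grad: "grad_fun (?\<phi> k) x - ?g x
      = (1/2) *\<^sub>R (grad_fun (\<phi> k) x - g x) + (1/2) *\<^sub>R (grad_fun (\<phi> k) (x + h) - g (x + h))" for k x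
    unfolding grad_fun_lincomb[OF sm smooth_fun_shift[OF sm]] grad_fun_shift
    by (simp add: algebra_simps)
  have mg: "(\<lambda>x. (norm (grad_fun (?\<phi> k) x - ?g x))\<^sup>2) \<in> borel_measurable lebesgue" for k
  proof -
    have "grad_fun (?\<phi> k) \<in> borel_measurable lebesgue"
      unfolding grad_fun_def
      by (intro borel_measurable_sum borel_measurable_scaleR borel_measurable_const test_fun_partial_measurable tf')
    from borel_measurable_diff[OF this has_weak_gradient_measurable(2)[OF wg]]
    show ?thesis by (intro borel_measurable_power measurable_compose[OF _ borel_measurable_norm])
  qed
  have mu: "(\<lambda>x. \<bar>?\<phi> k x - ?u x\<bar> powr ?p) \<in> borel_measurable lebesgue" for k
    using has_weak_gradient_measurable(1)[OF wg] test_fun_measurable[OF tf', of k]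
    by (intro powr_real_measurable borel_measurable_abs borel_measurable_diff borel_measurable_const)
  have G: "(norm (grad_fun (?\<phi> k) x - ?g x))\<^sup>2
      \<le> (norm (grad_fun (\<phi> k) x - g x))\<^sup>2 + (norm (grad_fun (\<phi> k) (x + h) - g (x + h)))\<^sup>2" for k x
    unfolding grad by (rule norm_mean_square_le)
  have U: "\<bar>?\<phi> k x - ?u x\<bar> powr ?p \<le> \<bar>\<phi> k x - u x\<bar> powr ?p + \<bar>\<phi> k (x + h) - u (x + h)\<bar> powr ?p" for k x
  proof -
    have "?\<phi> k x - ?u x = 1/2 * (\<phi> k x - u x) + 1/2 * (\<phi> k (x + h) - u (x + h))"
      by (simp add: algebra_simps)
    then show ?thesis
      using powr_abs_mean_le[of ?p] crit_exp_pos[OF dim] by simp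
  qed
  have L: "L2 lebesgue (\<lambda>x. norm (?g x))"
    unfolding L2_def
  proof
    show m: "(\<lambda>x. norm (?g x)) \<in> borel_measurable lebesgue"
      by (rule has_weak_gradient_norm_measurable[OF wg])
    have i: "integrable lebesgue (\<lambda>x. (norm (g x))\<^sup>2)" using A by (simp add: L2_def)
    then have "integrable lebesgue (\<lambda>x. (norm (g x))\<^sup>2 + (norm (g (x + h)))\<^sup>2)"
      by (intro Bochner_Integration.integrable_add lebesgue_integrable_shift[where f="\<lambda>x. (norm (g x))\<^sup>2"])
    then show "integrable lebesgue (\<lambda>x. (norm (?g x))\<^sup>2)"
      by (rule Bochner_Integration.integrable_bound)
         (use m in \<open>auto intro!: AE_I2 norm_mean_square_le borel_measurable_power\<close>)
  qed
  have e: "\<And>k. integrable lebesgue (\<lambda>x. (norm (grad_fun (\<phi> k) x - g x))\<^sup>2)"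
    "(\<lambda>k. \<integral>x. (norm (grad_fun (\<phi> k) x - g x))\<^sup>2 \<partial>lebesgue) \<longlonglongrightarrow> 0"
    "\<And>k. integrable lebesgue (\<lambda>x. \<bar>\<phi> k x - u x\<bar> powr ?p)"
    "(\<lambda>k. \<integral>x. \<bar>\<phi> k x - u x\<bar> powr ?p \<partial>lebesgue) \<longlonglongrightarrow> 0"
    using A by auto
  show ?thesis
    unfolding D12_approx_def
    using wg L tf' integral_tendsto_0_shifted_bound[OF e(1,2) mg _ G] integral_tendsto_0_shifted_bound[OF e(3,4) mu _ U]
    by simp
qed

lemma Xset_mean:
  fixes u :: "'a::euclidean_space \<Rightarrow> real"
  assumes u: "u \<in> Xset" and dim: "DIM('a) \<ge> 3"
  shows "(\<lambda>x. 1/2 * u x + 1/2 * u (x + h)) \<in> Xset"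
proof -
  let ?u = "\<lambda>x. 1/2 * u x + 1/2 * u (x + h)"
  obtain g \<phi> where "D12_approx u g \<phi>" using u by (auto simp: Xset_def D12_iff)
  then have 1: "D12 ?u" using D12_approx_mean[OF _ dim] D12_iff by blast
  obtain L where L: "L-lipschitz_on UNIV u" using u by (auto simp: Xset_def)
  have "\<bar>?u x - ?u y\<bar> \<le> L * dist x y" for x y
  proof -
    have "\<bar>u x - u y\<bar> \<le> L * dist x y" "\<bar>u (x + h) - u (y + h)\<bar> \<le> L * dist x y"
      using lipschitz_onD[OF L, of x y] lipschitz_onD[OF L, of "x + h" "y + h"]
      by (auto simp: dist_real_def)
    then show ?thesis by (simp add: abs_le_iff)
  qed
  then have 2: "L-lipschitz_on UNIV ?u"
    using lipschitz_on_nonneg[OF L] by (intro lipschitz_onI) (auto simp: dist_real_def)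
  obtain k where k: "has_weak_gradient u k" "AE x in lebesgue. norm (k x) \<le> 1"
    using u by (auto simp: Xset_def)
  have "has_weak_gradient ?u (\<lambda>x. (1/2) *\<^sub>R k x + (1/2) *\<^sub>R k (x + h))"
    by (intro has_weak_gradient_lincomb has_weak_gradient_shift k)
  moreover have "AE x in lebesgue. norm ((1/2) *\<^sub>R k x + (1/2) *\<^sub>R k (x + h)) \<le> 1"
    using k(2) lebesgue_AE_shift[OF k(2), of h]
    by eventually_elim (rule norm_triangle_le, simp)
  ultimately show ?thesis using 1 2 unfolding Xset_def by blast
qed

text \<open>Membership supplies one gradient that is approximated and another that is bounded by 1;
  by uniqueness the approximated one is bounded as well.\<close>

lemma Xset_data:
  fixes u :: "'a::euclidean_space \<Rightarrow> real"
  assumes "u \<in> Xset"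
  obtains g \<phi> where "D12_approx u g \<phi>" "AE x in lebesgue. norm (g x) \<le> 1"
proof -
  obtain g \<phi> where g: "D12_approx u g \<phi>" using assms by (auto simp: Xset_def D12_iff)
  obtain k where k: "has_weak_gradient u k" "AE x in lebesgue. norm (k x) \<le> 1"
    using assms by (auto simp: Xset_def)
  have "AE x in lebesgue. g x = k x"
    using g k by (intro weak_gradient_unique[of u]) (auto simp: D12_approx_def)
  with k(2) have "AE x in lebesgue. norm (g x) \<le> 1" by eventually_elim simp
  with g show ?thesis using that by blast
qed

section \<open>Exponents and integrability of the linear term\<close>

lemma Lp_interpolate:
  assumes "Lp m f" "Lp q f" "m \<le> r" "r \<le> q"
  shows "Lp r f"
  unfolding Lp_def
proof
  show m: "f \<in> borel_measurable lebesgue" using assms by (simp add: Lp_def)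
  have "integrable lebesgue (\<lambda>x. \<bar>f x\<bar> powr m + \<bar>f x\<bar> powr q)"
    using assms by (simp add: Lp_def)
  then show "integrable lebesgue (\<lambda>x. \<bar>f x\<bar> powr r)"
  proof (rule Bochner_Integration.integrable_bound)
    show "(\<lambda>x. \<bar>f x\<bar> powr r) \<in> borel_measurable lebesgue"
      using m by (intro powr_real_measurable borel_measurable_abs borel_measurable_const)
    \<comment> \<open>The smaller exponent dominates where |f| is at most 1, the larger one
      elsewhere.\<close>
    have "\<bar>f x\<bar> powr r \<le> \<bar>f x\<bar> powr m + \<bar>f x\<bar> powr q" for x
    proof (cases "\<bar>f x\<bar> \<le> 1")
      case True
      then have "\<bar>f x\<bar> powr r \<le> \<bar>f x\<bar> powr m" using assms by (intro powr_mono') auto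
      then show ?thesis by (simp add: add_increasing2)
    next
      case False
      then have "\<bar>f x\<bar> powr r \<le> \<bar>f x\<bar> powr q" using assms by (intro powr_mono) auto
      then show ?thesis by (simp add: add_increasing)
    qed
    then show "AE x in lebesgue. norm (\<bar>f x\<bar> powr r) \<le> norm (\<bar>f x\<bar> powr m + \<bar>f x\<bar> powr q)" by simp
  qed
qed

lemma D12_approx_Lp_crit:
  fixes u :: "'a::euclidean_space \<Rightarrow> real"
  assumes "D12_approx u g \<phi>" and dim: "DIM('a) \<ge> 3"
  shows "Lp (crit_exp TYPE('a)) u"
proof -
  let ?p = "crit_exp TYPE('a)"
  note A = assms(1)[unfolded D12_approx_def]
  have p: "?p > 1" by (rule crit_exp_pos[OF dim])
  have tf: "test_fun (\<phi> 0)" using A by blast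
  have um: "u \<in> borel_measurable lebesgue" using A has_weak_gradient_measurable by blast
  obtain R where R: "R > 0" "\<And>x. norm x > R \<Longrightarrow> \<phi> 0 x = 0" "\<And>x b. norm x > R \<Longrightarrow> partial b (\<phi> 0) x = 0"
    using test_fun_support[OF tf] by metis
  have "continuous_on UNIV (\<lambda>x. \<bar>\<phi> 0 x\<bar> powr ?p)"
    using tf p by (intro continuous_on_powr' continuous_intros smooth_fun_continuous) (auto simp: test_fun_def)
  then have i: "integrable lebesgue (\<lambda>x. \<bar>\<phi> 0 x\<bar> powr ?p)"
    by (rule integrable_compact_support[where R=R]) (simp add: R)
  have j: "integrable lebesgue (\<lambda>x. \<bar>\<phi> 0 x - u x\<bar> powr ?p)" using A by blast
  have "integrable lebesgue (\<lambda>x. 2 powr ?p * (\<bar>\<phi> 0 x\<bar> powr ?p + \<bar>\<phi> 0 x - u x\<bar> powr ?p))"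
    by (intro integrable_mult_right Bochner_Integration.integrable_add i j)
  then have "integrable lebesgue (\<lambda>x. \<bar>u x\<bar> powr ?p)"
  proof (rule Bochner_Integration.integrable_bound)
    show "(\<lambda>x. \<bar>u x\<bar> powr ?p) \<in> borel_measurable lebesgue"
      using um by (intro powr_real_measurable borel_measurable_abs borel_measurable_const)
    have "\<bar>u x\<bar> powr ?p \<le> 2 powr ?p * (\<bar>\<phi> 0 x\<bar> powr ?p + \<bar>\<phi> 0 x - u x\<bar> powr ?p)" for x
    proof -
      \<comment> \<open>u is twice the mean of the first approximant and the negated error, so the
        bound for powers of means applies, with the factor 2^p.\<close>
      have "1/2 * \<phi> 0 x + 1/2 * (- (\<phi> 0 x - u x)) = u x / 2" by (simp add: field_simps)
      then have "\<bar>u x\<bar> powr ?p = (2 * \<bar>1/2 * \<phi> 0 x + 1/2 * (- (\<phi> 0 x - u x))\<bar>) powr ?p"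
        by (simp only:) simp
      also have "\<dots> = 2 powr ?p * \<bar>1/2 * \<phi> 0 x + 1/2 * (- (\<phi> 0 x - u x))\<bar> powr ?p"
        by (rule powr_mult)
      also have "\<dots> \<le> 2 powr ?p * (\<bar>\<phi> 0 x\<bar> powr ?p + \<bar>- (\<phi> 0 x - u x)\<bar> powr ?p)"
        using p by (intro mult_left_mono powr_abs_mean_le) auto
      finally show ?thesis by (simp only: abs_minus_cancel)
    qed
    then show "AE x in lebesgue. norm (\<bar>u x\<bar> powr ?p) \<le> norm (2 powr ?p * (\<bar>\<phi> 0 x\<bar> powr ?p + \<bar>\<phi> 0 x - u x\<bar> powr ?p))"
      by simp
  qed
  with um show ?thesis by (simp add: Lp_def)
qed

lemma Lp_conjugate_integrable:
  assumes "Lp p f" "Lp r g" "p > 1" "r > 1" "1/p + 1/r = 1"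
  shows "integrable lebesgue (\<lambda>x. f x * g x)"
proof -
  have "integrable lebesgue (\<lambda>x. \<bar>f x\<bar> powr p / p + \<bar>g x\<bar> powr r / r)"
    using assms by (simp add: Lp_def)
  then show ?thesis
  proof (rule Bochner_Integration.integrable_bound)
    show "(\<lambda>x. f x * g x) \<in> borel_measurable lebesgue"
      using assms by (intro borel_measurable_times) (auto simp: Lp_def)
    show "AE x in lebesgue. norm (f x * g x) \<le> norm (\<bar>f x\<bar> powr p / p + \<bar>g x\<bar> powr r / r)"
      using Youngs_inequality[OF assms(3-5)] assms(3,4)
      by (intro AE_I2) (auto simp: abs_mult intro: order_trans[OF _ abs_ge_self])
  qed
qed

lemma Lp_shift: "Lp p f \<Longrightarrow> Lp p (\<lambda>x. f (x + h))"
  unfolding Lp_def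
  using lebesgue_integrable_shift[of "\<lambda>x. \<bar>f x\<bar> powr p" h] by (auto intro: lebesgue_measurable_shift_fun)

text \<open>The second difference is the increment, with step -t, of the increment with step t.
  Hence \<open>test_fun_increment_L2\<close> bounds it for approximants by t times the norm of the
  increment of their gradients. The latter is compared with the increment of \<open>g\<close>, and
  Fatou's lemma transfers the bound to u.\<close>

lemma second_difference_L2:
  fixes u :: "'a::euclidean_space \<Rightarrow> real"
  assumes "D12_approx u g \<phi>" and dim: "DIM('a) \<ge> 3" and b: "b \<in> Basis" and t: "0 < t" "t \<le> 1"
  defines "S \<equiv> \<lambda>x. 2 * u x - u (x + t *\<^sub>R b) - u (x + (- t) *\<^sub>R b)"
    and "D \<equiv> (\<integral>x. (norm (g (x + t *\<^sub>R b) - g x))\<^sup>2 \<partial>lebesgue)"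
  assumes Di: "integrable lebesgue (\<lambda>x. (norm (g (x + t *\<^sub>R b) - g x))\<^sup>2)"
  shows "L2 lebesgue S" "(\<integral>x. (S x)\<^sup>2 \<partial>lebesgue) \<le> 3 * t\<^sup>2 * D"
proof -
  let ?p = "crit_exp TYPE('a)" and ?h = "t *\<^sub>R b"
  note A = assms(1)[unfolded D12_approx_def]
  have p: "?p > 1" by (rule crit_exp_pos[OF dim])
  have tf: "test_fun (\<phi> k)" for k using A by blast
  have sm: "smooth_fun (\<phi> k)" for k using tf[of k] by (simp add: test_fun_def)
  have um: "u \<in> borel_measurable lebesgue" using A has_weak_gradient_measurable by blast
  have ei: "integrable lebesgue (\<lambda>x. (norm (grad_fun (\<phi> k) x - g x))\<^sup>2)" for k using A by blast
  define e where "e k = (\<integral>x. (norm (grad_fun (\<phi> k) x - g x))\<^sup>2 \<partial>lebesgue)" for k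
  have e0: "e \<longlonglongrightarrow> 0" using A by (simp add: e_def[abs_def])
  define s where "s k x = 2 * \<phi> k x - \<phi> k (x + ?h) - \<phi> k (x + (- t) *\<^sub>R b)" for k x
  have sL: "L2 lebesgue (s k)" for k
  proof -
    note L = test_fun_L2(1)[OF tf[of k]]
    have "L2 lebesgue (\<lambda>x. 2 * \<phi> k x)" using L2_lincomb[OF L L, of 2 0] by simp
    then show ?thesis unfolding s_def by (intro L2_diff L2_shift L)
  qed
  have sb: "(\<integral>x. (s k x)\<^sup>2 \<partial>lebesgue) \<le> t\<^sup>2 * (3 * (2 * e k + D))" for k
  proof -
    let ?\<psi> = "\<lambda>x. 1 * \<phi> k (x + ?h) + (- 1) * \<phi> k x"
    have \<psi>: "test_fun ?\<psi>" by (intro test_fun_lincomb test_fun_shift tf)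
    have "s k x = ?\<psi> (x + (- t) *\<^sub>R b) - ?\<psi> x" for x
      by (simp add: s_def)
    then have "(\<integral>x. (s k x)\<^sup>2 \<partial>lebesgue) = (\<integral>x. (?\<psi> (x + (- t) *\<^sub>R b) - ?\<psi> x)\<^sup>2 \<partial>lebesgue)"
      by (simp only:)
    also have "\<dots> \<le> (- t)\<^sup>2 * (\<integral>x. (partial b ?\<psi> x)\<^sup>2 \<partial>lebesgue)"
      using t by (intro test_fun_increment_L2[OF \<psi> b]) auto
    also have "(\<integral>x. (partial b ?\<psi> x)\<^sup>2 \<partial>lebesgue) \<le> 3 * (2 * e k + D)"
    proof -
      \<comment> \<open>The increment of the approximant's gradient splits into the error at x + h,
        the increment of \<open>g\<close> and the error at x. Both errors integrate to
        \<open>e k\<close>; the factor 3 comes from squaring a sum of three terms.\<close>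
      let ?n1 = "\<lambda>x. (norm (grad_fun (\<phi> k) (x + ?h) - g (x + ?h)))\<^sup>2"
        and ?n2 = "\<lambda>x. (norm (g (x + ?h) - g x))\<^sup>2" and ?n3 = "\<lambda>x. (norm (grad_fun (\<phi> k) x - g x))\<^sup>2"
      have n1: "integrable lebesgue ?n1"
        by (rule lebesgue_integrable_shift[OF ei])
      have n1': "(\<integral>x. ?n1 x \<partial>lebesgue) = e k"
        unfolding e_def by (rule lebesgue_integral_shift[OF borel_measurable_integrable[OF ei]])
      have pw: "(partial b ?\<psi> x)\<^sup>2 \<le> 3 * (?n1 x + ?n2 x + ?n3 x)" for x
      proof -
        let ?a = "grad_fun (\<phi> k) (x + ?h) - g (x + ?h)" and ?c = "g (x + ?h) - g x" and ?d = "grad_fun (\<phi> k) x - g x"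
        have "partial b ?\<psi> x = (?a + ?c - ?d) \<bullet> b"
          unfolding partial_lincomb[OF smooth_fun_shift[OF sm] sm b] partial_shift
          using b by (simp add: inner_diff_left inner_add_left grad_fun_inner)
        then have "\<bar>partial b ?\<psi> x\<bar> \<le> norm (?a + ?c - ?d)"
          using Basis_le_norm[OF b, of "?a + ?c - ?d"] by (simp only:)
        also have "\<dots> \<le> norm ?a + norm ?c + norm ?d"
          by (rule order_trans[OF norm_triangle_ineq4 add_right_mono[OF norm_triangle_ineq]])
        finally have "(partial b ?\<psi> x)\<^sup>2 \<le> (norm ?a + norm ?c + norm ?d)\<^sup>2"
          by (intro abs_le_square_iff[THEN iffD1]) simp
        also have "\<dots> \<le> 3 * ((norm ?a)\<^sup>2 + (norm ?c)\<^sup>2 + (norm ?d)\<^sup>2)"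
        proof -
          have "(y + z + w)\<^sup>2 \<le> 3 * (y\<^sup>2 + z\<^sup>2 + w\<^sup>2)" for y z w :: real
            using sum_squares_bound[of y z] sum_squares_bound[of y w] sum_squares_bound[of z w]
            by (simp add: power2_eq_square algebra_simps)
          then show ?thesis by blast
        qed
        finally show ?thesis .
      qed
      have "(\<integral>x. (partial b ?\<psi> x)\<^sup>2 \<partial>lebesgue) \<le> (\<integral>x. 3 * (?n1 x + ?n2 x + ?n3 x) \<partial>lebesgue)"
        using test_fun_L2(2)[OF \<psi> b] n1 Di ei[of k] pw by (intro integral_mono) (auto simp: L2_def)
      also have "\<dots> = 3 * (2 * e k + D)"
        using n1 Di ei[of k] n1' by (simp add: D_def e_def)
      finally show ?thesis .
    qed
    finally show ?thesis using t by (simp add: mult_left_mono)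
  qed
  \<comment> \<open>Fatou's lemma needs pointwise limits; convergence in the critical norm provides
    them along a subsequence.\<close>
  obtain r where r: "strict_mono r" "AE x in lebesgue. (\<lambda>n. \<bar>\<phi> (r n) x - u x\<bar> powr ?p) \<longlonglongrightarrow> 0"
    using tendsto_L1_AE_subseq[of lebesgue "\<lambda>k x. \<bar>\<phi> k x - u x\<bar> powr ?p"] A by auto
  from r(2) have lim: "AE x in lebesgue. (\<lambda>n. \<phi> (r n) x) \<longlonglongrightarrow> u x"
  proof eventually_elim
    case (elim x)
    have "(\<lambda>n. (\<bar>\<phi> (r n) x - u x\<bar> powr ?p) powr (1 / ?p)) \<longlonglongrightarrow> 0 powr (1 / ?p)"
      using p by (intro tendsto_powr2[OF elim tendsto_const]) auto
    then have "(\<lambda>n. \<bar>\<phi> (r n) x - u x\<bar>) \<longlonglongrightarrow> 0"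
      using p by (simp add: powr_powr)
    then show ?case by (simp add: tendsto_rabs_zero_iff LIM_zero_iff)
  qed
  have slim: "AE x in lebesgue. (\<lambda>n. s (r n) x) \<longlonglongrightarrow> S x"
    using lim lebesgue_AE_shift[OF lim, of ?h] lebesgue_AE_shift[OF lim, of "(- t) *\<^sub>R b"]
  proof eventually_elim
    case (elim x)
    then show ?case unfolding s_def S_def by (intro tendsto_diff tendsto_mult tendsto_const)
  qed
  have c: "(\<lambda>n. t\<^sup>2 * (3 * (2 * e (r n) + D))) \<longlonglongrightarrow> t\<^sup>2 * (3 * (2 * 0 + D))"
    using LIMSEQ_subseq_LIMSEQ[OF e0 r(1)] by (intro tendsto_intros) (simp add: o_def)
  have Sm: "S \<in> borel_measurable lebesgue"
    unfolding S_def using um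
    by (intro borel_measurable_diff borel_measurable_times borel_measurable_const lebesgue_measurable_shift_fun)
  show "L2 lebesgue S" by (rule L2_Fatou(1)[OF sL sb c Sm slim])
  show "(\<integral>x. (S x)\<^sup>2 \<partial>lebesgue) \<le> 3 * t\<^sup>2 * D"
    using L2_Fatou(2)[OF sL sb c Sm slim] by (simp add: mult_ac)
qed

section \<open>The Born--Infeld energy\<close>

text \<open>The points (p, sqrt (1 - |p|^2)) lie on the unit sphere, so the parallelogram identity
  measures how far the graph of the root lies above the midpoint of a chord.\<close>

lemma energy_density_uniformly_convex:
  fixes p q :: "'a::euclidean_space"
  assumes "norm p \<le> 1" "norm q \<le> 1"
  shows "1 - sqrt (1 - (norm ((1/2) *\<^sub>R p + (1/2) *\<^sub>R q))\<^sup>2)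
    \<le> 1/2 * (1 - sqrt (1 - (norm p)\<^sup>2)) + 1/2 * (1 - sqrt (1 - (norm q)\<^sup>2)) - 1/16 * (norm (p - q))\<^sup>2"
proof -
  define a c d where "a = sqrt (1 - (norm p)\<^sup>2)" and "c = sqrt (1 - (norm q)\<^sup>2)" and "d = (norm (p - q))\<^sup>2"
  have sq: "(norm p)\<^sup>2 \<le> 1" "(norm q)\<^sup>2 \<le> 1" using assms by (auto simp: power_le_one)
  have a: "a\<^sup>2 = 1 - (norm p)\<^sup>2" "0 \<le> a" "a \<le> 1" using sq by (auto simp: a_def)
  have c: "c\<^sup>2 = 1 - (norm q)\<^sup>2" "0 \<le> c" "c \<le> 1" using sq by (auto simp: c_def)
  have mid: "(norm ((1/2) *\<^sub>R p + (1/2) *\<^sub>R q))\<^sup>2 = ((norm p)\<^sup>2 + (norm q)\<^sup>2) / 2 - d / 4"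
    unfolding d_def power2_norm_eq_inner by (simp add: inner_simps inner_commute field_simps)
  have d: "0 \<le> d" "d \<le> 4"
  proof -
    have "norm (p - q) \<le> 2" using norm_triangle_ineq4[of p q] assms by linarith
    then have "(norm (p - q))\<^sup>2 \<le> 2\<^sup>2" by (intro power_mono) auto
    then show "0 \<le> d" "d \<le> 4" by (auto simp: d_def)
  qed
  have "((a + c) / 2 + d / 16)\<^sup>2 \<le> 1 - (norm ((1/2) *\<^sub>R p + (1/2) *\<^sub>R q))\<^sup>2"
  proof -
    have 1: "1 - (norm ((1/2) *\<^sub>R p + (1/2) *\<^sub>R q))\<^sup>2 = (a\<^sup>2 + c\<^sup>2) / 2 + d / 4"
      unfolding mid a(1) c(1) by (simp add: field_simps)
    \<comment> \<open>These bounds explain the constant 1/16: squaring the sum adds at most d/8 +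
      d/64 to ((a + c)/2)^2, which stays below the available d/4.\<close>
    have 2: "(a + c) * d \<le> 2 * d" "d * d \<le> 4 * d"
      using a c d by (auto intro!: mult_right_mono)
    have 3: "((a + c) / 2)\<^sup>2 \<le> (a\<^sup>2 + c\<^sup>2) / 2"
      using sum_squares_bound[of a c] by (simp add: power2_eq_square field_simps)
    have "((a + c) / 2 + d / 16)\<^sup>2 = ((a + c) / 2)\<^sup>2 + (a + c) * d / 16 + d * d / 256"
      by (simp add: power2_eq_square field_simps)
    then show ?thesis unfolding 1 using 2 3 d by linarith
  qed
  then have "(a + c) / 2 + d / 16 \<le> sqrt (1 - (norm ((1/2) *\<^sub>R p + (1/2) *\<^sub>R q))\<^sup>2)"
    by (rule real_le_rsqrt)
  then show ?thesis unfolding a_def c_def d_def by argo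
qed

text \<open>A number in [0, 1] is at most its square root. The upper bound makes the energy finite
  whenever the Dirichlet integral is.\<close>

lemma energy_density_bounds:
  assumes "norm p \<le> 1"
  shows "0 \<le> 1 - sqrt (1 - (norm p)\<^sup>2)" "1 - sqrt (1 - (norm p)\<^sup>2) \<le> (norm p)\<^sup>2"
proof -
  have s: "0 \<le> 1 - (norm p)\<^sup>2" "1 - (norm p)\<^sup>2 \<le> 1" using assms by (auto simp: power_le_one)
  then show "0 \<le> 1 - sqrt (1 - (norm p)\<^sup>2)" by simp
  have "1 - (norm p)\<^sup>2 \<le> sqrt (1 - (norm p)\<^sup>2)"
    using s by (intro real_le_rsqrt) (simp add: power2_eq_square mult_left_le)
  then show "1 - sqrt (1 - (norm p)\<^sup>2) \<le> (norm p)\<^sup>2" by simp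
qed

lemma energy_integrable:
  fixes g :: "'a::euclidean_space \<Rightarrow> 'a"
  assumes m: "g \<in> borel_measurable lebesgue" and L: "L2 lebesgue (\<lambda>x. norm (g x))"
    and 1: "AE x in lebesgue. norm (g x) \<le> 1"
  shows "integrable lebesgue (\<lambda>x. 1 - sqrt (1 - (norm (g x))\<^sup>2))"
proof (rule Bochner_Integration.integrable_bound)
  show "integrable lebesgue (\<lambda>x. (norm (g x))\<^sup>2)" using L by (simp add: L2_def)
  show "(\<lambda>x. 1 - sqrt (1 - (norm (g x))\<^sup>2)) \<in> borel_measurable lebesgue"
    using m by measurable
  show "AE x in lebesgue. norm (1 - sqrt (1 - (norm (g x))\<^sup>2)) \<le> norm ((norm (g x))\<^sup>2)"
    using 1
  proof eventually_elim
    case (elim x)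
    show ?case using energy_density_bounds[OF elim] by simp
  qed
qed

lemma I_rho_eq:
  assumes g: "has_weak_gradient u g"
  shows "I_rho \<rho> u = (\<integral>x. 1 - sqrt (1 - (norm (g x))\<^sup>2) \<partial>lebesgue) - (\<integral>x. \<rho> x * u x \<partial>lebesgue)"
proof -
  have w: "has_weak_gradient u (weak_grad u)"
    unfolding weak_grad_def by (rule someI[of "has_weak_gradient u", OF g])
  note [measurable] = has_weak_gradient_measurable(2)[OF g] has_weak_gradient_measurable(2)[OF w]
  have "(\<integral>x. 1 - sqrt (1 - (norm (weak_grad u x))\<^sup>2) \<partial>lebesgue) = (\<integral>x. 1 - sqrt (1 - (norm (g x))\<^sup>2) \<partial>lebesgue)"
  proof (rule integral_cong_AE)
    show "AE x in lebesgue. 1 - sqrt (1 - (norm (weak_grad u x))\<^sup>2) = 1 - sqrt (1 - (norm (g x))\<^sup>2)"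
      using weak_grad_AE_eq[OF g] by eventually_elim simp
  qed measurable
  then show ?thesis by (simp add: I_rho_def)
qed

text \<open>u and its translate have equal energies, so comparison with their mean cancels these.
  What remains is 1/16 of the squared increment against half the change of the linear term; doubling
  gives 1/8.\<close>

lemma minimizer_increment_estimate:
  fixes u :: "'a::euclidean_space \<Rightarrow> real"
  assumes dim: "DIM('a) \<ge> 3" and u: "u \<in> Xset" and min: "\<forall>v\<in>Xset. I_rho \<rho> u \<le> I_rho \<rho> v"
    and D: "D12_approx u g \<phi>" and g1: "AE x in lebesgue. norm (g x) \<le> 1"
    and \<rho>: "\<And>h. integrable lebesgue (\<lambda>x. \<rho> x * u (x + h))"
  shows "integrable lebesgue (\<lambda>x. (norm (g (x + h) - g x))\<^sup>2)"
    and "1/8 * (\<integral>x. (norm (g (x + h) - g x))\<^sup>2 \<partial>lebesgue)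
      \<le> (\<integral>x. \<rho> x * u x \<partial>lebesgue) - (\<integral>x. \<rho> x * u (x + h) \<partial>lebesgue)"
proof -
  let ?F = "\<lambda>p::'a. 1 - sqrt (1 - (norm p)\<^sup>2)"
  let ?g = "\<lambda>x. (1/2) *\<^sub>R g x + (1/2) *\<^sub>R g (x + h)" and ?w = "\<lambda>x. 1/2 * u x + 1/2 * u (x + h)"
  have wg: "has_weak_gradient u g" and gL: "L2 lebesgue (\<lambda>x. norm (g x))"
    using D by (auto simp: D12_approx_def)
  note gm [measurable] = has_weak_gradient_measurable(2)[OF wg]
  have ghm [measurable]: "(\<lambda>x. g (x + h)) \<in> borel_measurable lebesgue"
    by (rule lebesgue_measurable_shift_fun[OF gm])
  have "integrable lebesgue (\<lambda>x. 2 * ((norm (g x))\<^sup>2 + (norm (g (x + h)))\<^sup>2))"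
    using gL lebesgue_integrable_shift[of "\<lambda>x. (norm (g x))\<^sup>2" h] by (simp add: L2_def)
  then show Di: "integrable lebesgue (\<lambda>x. (norm (g (x + h) - g x))\<^sup>2)"
  proof (rule Bochner_Integration.integrable_bound)
    show "AE x in lebesgue. norm ((norm (g (x + h) - g x))\<^sup>2) \<le> norm (2 * ((norm (g x))\<^sup>2 + (norm (g (x + h)))\<^sup>2))"
    proof (rule AE_I2)
      fix x
      have "(norm (g (x + h) - g x))\<^sup>2 \<le> (norm (g (x + h)) + norm (g x))\<^sup>2"
        by (intro power_mono norm_triangle_ineq4) auto
      also have "\<dots> \<le> 2 * ((norm (g x))\<^sup>2 + (norm (g (x + h)))\<^sup>2)"
        using sum_squares_bound[of "norm (g (x + h))" "norm (g x)"] by (simp add: power2_sum)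
      finally show "norm ((norm (g (x + h) - g x))\<^sup>2) \<le> norm (2 * ((norm (g x))\<^sup>2 + (norm (g (x + h)))\<^sup>2))" by simp
    qed
  qed measurable
  have D': "D12_approx ?w ?g (\<lambda>k x. 1/2 * \<phi> k x + 1/2 * \<phi> k (x + h))"
    by (rule D12_approx_mean[OF D dim])
  then have wg': "has_weak_gradient ?w ?g" and gL': "L2 lebesgue (\<lambda>x. norm (?g x))"
    by (auto simp: D12_approx_def)
  have g1h: "AE x in lebesgue. norm (g (x + h)) \<le> 1" by (rule lebesgue_AE_shift[OF g1])
  have g1': "AE x in lebesgue. norm (?g x) \<le> 1"
    using g1 g1h by eventually_elim (rule norm_triangle_le, simp)
  have i1: "integrable lebesgue (\<lambda>x. ?F (g x))" by (rule energy_integrable[OF gm gL g1])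
  have i2: "integrable lebesgue (\<lambda>x. ?F (g (x + h)))" by (rule lebesgue_integrable_shift[OF i1])
  have i3: "integrable lebesgue (\<lambda>x. ?F (?g x))"
    by (rule energy_integrable[OF has_weak_gradient_measurable(2)[OF wg'] gL' g1'])
  have sh: "(\<integral>x. ?F (g (x + h)) \<partial>lebesgue) = (\<integral>x. ?F (g x) \<partial>lebesgue)"
    by (rule lebesgue_integral_shift[OF borel_measurable_integrable[OF i1]])
  let ?D = "\<integral>x. (norm (g (x + h) - g x))\<^sup>2 \<partial>lebesgue"
  have "(\<integral>x. ?F (?g x) \<partial>lebesgue)
      \<le> (\<integral>x. 1/2 * ?F (g x) + 1/2 * ?F (g (x + h)) - 1/16 * (norm (g (x + h) - g x))\<^sup>2 \<partial>lebesgue)"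
  proof (rule integral_mono_AE)
    show "integrable lebesgue (\<lambda>x. 1/2 * ?F (g x) + 1/2 * ?F (g (x + h)) - 1/16 * (norm (g (x + h) - g x))\<^sup>2)"
      by (intro Bochner_Integration.integrable_diff Bochner_Integration.integrable_add integrable_mult_right i1 i2 Di)
    show "AE x in lebesgue. ?F (?g x) \<le> 1/2 * ?F (g x) + 1/2 * ?F (g (x + h)) - 1/16 * (norm (g (x + h) - g x))\<^sup>2"
      using g1 g1h
    proof eventually_elim
      case (elim x)
      show ?case using energy_density_uniformly_convex[OF elim] by (simp only: norm_minus_commute[of "g x"])
    qed
  qed (rule i3)
  also have "\<dots> = 1/2 * (\<integral>x. ?F (g x) \<partial>lebesgue) + 1/2 * (\<integral>x. ?F (g (x + h)) \<partial>lebesgue) - 1/16 * ?D"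
    by (subst Bochner_Integration.integral_diff, intro Bochner_Integration.integrable_add integrable_mult_right i1 i2,
        intro integrable_mult_right Di, subst Bochner_Integration.integral_add,
        (intro integrable_mult_right i1 i2)+) (simp only: integral_mult_right_zero)
  finally have J: "(\<integral>x. ?F (?g x) \<partial>lebesgue) \<le> (\<integral>x. ?F (g x) \<partial>lebesgue) - 1/16 * ?D"
    unfolding sh by argo
  have lin: "(\<integral>x. \<rho> x * ?w x \<partial>lebesgue)
      = 1/2 * (\<integral>x. \<rho> x * u x \<partial>lebesgue) + 1/2 * (\<integral>x. \<rho> x * u (x + h) \<partial>lebesgue)"
  proof -
    have "(\<integral>x. \<rho> x * ?w x \<partial>lebesgue) = (\<integral>x. 1/2 * (\<rho> x * u x) + 1/2 * (\<rho> x * u (x + h)) \<partial>lebesgue)"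
      by (intro Bochner_Integration.integral_cong) (auto simp: algebra_simps)
    also have "\<dots> = 1/2 * (\<integral>x. \<rho> x * u x \<partial>lebesgue) + 1/2 * (\<integral>x. \<rho> x * u (x + h) \<partial>lebesgue)"
      using \<rho>[of 0] \<rho>[of h] by (subst Bochner_Integration.integral_add) auto
    finally show ?thesis .
  qed
  have "I_rho \<rho> u \<le> I_rho \<rho> ?w" using min Xset_mean[OF u dim] by blast
  then show "1/8 * ?D \<le> (\<integral>x. \<rho> x * u x \<partial>lebesgue) - (\<integral>x. \<rho> x * u (x + h) \<partial>lebesgue)"
    unfolding I_rho_eq[OF wg] I_rho_eq[OF wg'] lin using J by argo
qed

text \<open>With Q the squared increment norm, the two inequalities add up to Q/4 <= integral of rho
  S. Squaring and Cauchy-Schwarz give Q^2/16 <= 3 P t^2 Q, and cancelling one Q leaves the constant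
  48.\<close>

theorem minimizer_gradient_translation:
  fixes u :: "'a::euclidean_space \<Rightarrow> real"
  assumes dim: "DIM('a) \<ge> 3" and u: "u \<in> Xset" and min: "\<forall>v\<in>Xset. I_rho \<rho> u \<le> I_rho \<rho> v"
    and D: "D12_approx u g \<phi>" and g1: "AE x in lebesgue. norm (g x) \<le> 1"
    and \<rho>: "\<And>h. integrable lebesgue (\<lambda>x. \<rho> x * u (x + h))" and \<rho>2: "L2 lebesgue \<rho>"
    and b: "b \<in> Basis" and t: "0 < t" "t \<le> 1"
  shows "(\<integral>x. (norm (g (x + t *\<^sub>R b) - g x))\<^sup>2 \<partial>lebesgue) \<le> 48 * (\<integral>x. (\<rho> x)\<^sup>2 \<partial>lebesgue) * t\<^sup>2"
proof -
  define Q where "Q = (\<integral>x. (norm (g (x + t *\<^sub>R b) - g x))\<^sup>2 \<partial>lebesgue)"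
  define P where "P = (\<integral>x. (\<rho> x)\<^sup>2 \<partial>lebesgue)"
  define S where "S x = 2 * u x - u (x + t *\<^sub>R b) - u (x + (- t) *\<^sub>R b)" for x
  note est = minimizer_increment_estimate[OF dim u min D g1 \<rho>]
  have SL: "L2 lebesgue S" "(\<integral>x. (S x)\<^sup>2 \<partial>lebesgue) \<le> 3 * t\<^sup>2 * Q"
    unfolding S_def[abs_def] Q_def by (rule second_difference_L2[OF D dim b t est(1)])+
  \<comment> \<open>The increment with step -t is, up to sign, a translate of the one with step
    t.\<close>
  have "(\<integral>x. (norm (g (x + (- t) *\<^sub>R b) - g x))\<^sup>2 \<partial>lebesgue) = Q"
    using lebesgue_integral_shift[OF borel_measurable_integrable[OF est(1)], of "(- t) *\<^sub>R b" "t *\<^sub>R b"]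
    by (simp add: Q_def norm_minus_commute)
  then have "1/4 * Q \<le> 2 * (\<integral>x. \<rho> x * u x \<partial>lebesgue)
      - (\<integral>x. \<rho> x * u (x + t *\<^sub>R b) \<partial>lebesgue) - (\<integral>x. \<rho> x * u (x + (- t) *\<^sub>R b) \<partial>lebesgue)"
    using est(2)[of "t *\<^sub>R b"] est(2)[of "(- t) *\<^sub>R b"] unfolding Q_def by argo
  also have "\<dots> = (\<integral>x. \<rho> x * S x \<partial>lebesgue)"
  proof -
    have "\<rho> x * S x = 2 * (\<rho> x * u x) - \<rho> x * u (x + t *\<^sub>R b) - \<rho> x * u (x + (- t) *\<^sub>R b)" for x
      by (simp add: S_def algebra_simps)
    then show ?thesis
      using \<rho>[of 0] \<rho>[of "t *\<^sub>R b"] \<rho>[of "(- t) *\<^sub>R b"] by simp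
  qed
  finally have "1/4 * Q \<le> (\<integral>x. \<rho> x * S x \<partial>lebesgue)" .
  moreover have "Q \<ge> 0" by (simp add: Q_def)
  ultimately have "(1/4 * Q)\<^sup>2 \<le> (\<integral>x. \<rho> x * S x \<partial>lebesgue)\<^sup>2"
    by (intro power_mono) auto
  also have "\<dots> \<le> P * (\<integral>x. (S x)\<^sup>2 \<partial>lebesgue)"
    unfolding P_def by (rule L2_Cauchy_Schwarz[OF \<rho>2 SL(1)])
  also have "\<dots> \<le> P * (3 * t\<^sup>2 * Q)"
    using SL(2) by (intro mult_left_mono) (auto simp: P_def)
  finally have "Q * Q \<le> (48 * P * t\<^sup>2) * Q" by (simp add: power2_eq_square algebra_simps)
  then have "Q \<le> 48 * P * t\<^sup>2"
    using \<open>Q \<ge> 0\<close> by (cases "Q = 0") (auto simp: P_def)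
  then show ?thesis by (simp add: Q_def P_def)
qed

section \<open>Local second-order regularity of the minimizer\<close>

lemma lipschitz_L2_loc:
  fixes u :: "'a::euclidean_space \<Rightarrow> real"
  assumes "L-lipschitz_on UNIV u"
  shows "L2_loc u"
  unfolding L2_loc_def
proof (intro conjI allI impI)
  have c: "continuous_on UNIV u" using assms by (rule lipschitz_on_continuous_on)
  then show "u \<in> borel_measurable lebesgue" by (rule continuous_borel_lebesgue)
  fix K :: "'a set" assume "compact K"
  then have "integrable lborel (\<lambda>x. indicator K x *\<^sub>R (u x)\<^sup>2)"
    by (rule borel_integrable_compact) (intro continuous_intros continuous_on_subset[OF c], simp)
  then show "set_integrable lebesgue K (\<lambda>x. (u x)\<^sup>2)"
    unfolding set_integrable_def by (simp add: integrable_completion borel_measurable_integrable)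
qed

theorem theorem1p5:
  fixes \<rho> u :: "'a::euclidean_space \<Rightarrow> real" and q m :: real
  assumes "DIM('a) \<ge> 3"
    and "q > 2 * real DIM('a)"
    and "1 \<le> m" and "m \<le> 2 * real DIM('a) / (real DIM('a) + 2)"
    and "Lp q \<rho>" and "Lp m \<rho>"
    and "u \<in> Xset"
    and "\<forall>v\<in>Xset. I_rho \<rho> u \<le> I_rho \<rho> v"
  shows "W22_loc u"
proof -
  let ?N = "real DIM('a)"
  note dim = assms(1)
  have N: "?N \<ge> 3" using dim by simp
  obtain g \<phi> where D: "D12_approx u g \<phi>" and g1: "AE x in lebesgue. norm (g x) \<le> 1"
    using Xset_data[OF assms(7)] by blast
  have wg: "has_weak_gradient u g" and gL: "L2 lebesgue (\<lambda>x. norm (g x))"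
    using D by (auto simp: D12_approx_def)
  \<comment> \<open>This is 2_*, the conjugate of \<open>crit_exp\<close>. Both it and 2 lie between
    m and q, so interpolation gives rho in both spaces: the first pairs rho with u, the second with
    second differences.\<close>
  define r where "r = 2 * ?N / (?N + 2)"
  have r: "1 < r" "r \<le> 2" using N by (auto simp: r_def less_divide_eq divide_le_eq)
  have "Lp r \<rho>" "Lp 2 \<rho>"
    using Lp_interpolate[OF assms(6,5)] assms(2,4) r N by (auto simp: r_def)
  then have \<rho>2: "L2 lebesgue \<rho>" by (simp add: Lp_def L2_def)
  have conj: "1 / r + 1 / crit_exp TYPE('a) = 1"
    using N by (simp add: r_def crit_exp_def field_simps)
  have \<rho>: "integrable lebesgue (\<lambda>x. \<rho> x * u (x + h))" for h
    by (rule Lp_conjugate_integrable[OF \<open>Lp r \<rho>\<close> Lp_shift[OF D12_approx_Lp_crit[OF D dim]] r(1) crit_exp_pos[OF dim] conj])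
  \<comment> \<open>Any null sequence in (0, 1] would serve; \<open>Suc\<close> avoids the index 0,
    where the inverse would be 0.\<close>
  define s where "s n = inverse (real (Suc n))" for n
  have s: "s \<longlonglongrightarrow> 0" "\<And>n. 0 < s n" "\<And>n. s n \<le> 1"
    using LIMSEQ_inverse_real_of_nat by (auto simp: s_def[abs_def] inverse_le_1_iff)
  have gbL: "L2 lebesgue (\<lambda>x. g x \<bullet> c)" if c: "c \<in> Basis" for c
    unfolding L2_def
  proof
    show m: "(\<lambda>x. g x \<bullet> c) \<in> borel_measurable lebesgue"
      using wg c by (auto simp: has_weak_gradient_def L1_loc_def)
    have "(g x \<bullet> c)\<^sup>2 \<le> (norm (g x))\<^sup>2" for x
      using Basis_le_norm[OF c, of "g x"] by (intro abs_le_square_iff[THEN iffD1]) simp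
    then have "AE x in lebesgue. norm ((g x \<bullet> c)\<^sup>2) \<le> norm ((norm (g x))\<^sup>2)" by simp
    moreover have "integrable lebesgue (\<lambda>x. (norm (g x))\<^sup>2)" using gL by (simp add: L2_def)
    ultimately show "integrable lebesgue (\<lambda>x. (g x \<bullet> c)\<^sup>2)"
      using borel_measurable_power[OF m, of 2] by (rule Bochner_Integration.integrable_bound[rotated -1])
  qed
  have 2: "\<exists>h. has_weak_gradient (\<lambda>x. g x \<bullet> c) h \<and> (\<forall>b\<in>Basis. L2_loc (\<lambda>x. h x \<bullet> b))" if c: "c \<in> Basis" for c
  proof -
    have "\<exists>G. L2 lebesgue G \<and> (\<forall>\<phi>. test_fun \<phi> \<longrightarrow>
        (\<integral>x. (g x \<bullet> c) * partial b \<phi> x \<partial>lebesgue) = - (\<integral>x. G x * \<phi> x \<partial>lebesgue))" if b: "b \<in> Basis" for b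
    proof (rule weak_derivative_of_quotients[OF gbL[OF c] b s])
      fix n
      have "(\<integral>x. (g (x + s n *\<^sub>R b) \<bullet> c - g x \<bullet> c)\<^sup>2 \<partial>lebesgue) \<le> (\<integral>x. (norm (g (x + s n *\<^sub>R b) - g x))\<^sup>2 \<partial>lebesgue)"
      proof (rule integral_mono)
        show "integrable lebesgue (\<lambda>x. (g (x + s n *\<^sub>R b) \<bullet> c - g x \<bullet> c)\<^sup>2)"
          using L2_diff[OF L2_shift[OF gbL[OF c]] gbL[OF c]] by (simp add: L2_def)
        show "integrable lebesgue (\<lambda>x. (norm (g (x + s n *\<^sub>R b) - g x))\<^sup>2)"
          by (rule minimizer_increment_estimate(1)[OF dim assms(7,8) D g1 \<rho>])
        show "(g (x + s n *\<^sub>R b) \<bullet> c - g x \<bullet> c)\<^sup>2 \<le> (norm (g (x + s n *\<^sub>R b) - g x))\<^sup>2" for x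
          using Basis_le_norm[OF c, of "g (x + s n *\<^sub>R b) - g x"]
          by (intro abs_le_square_iff[THEN iffD1]) (simp add: inner_diff_left)
      qed
      also have "\<dots> \<le> 48 * (\<integral>x. (\<rho> x)\<^sup>2 \<partial>lebesgue) * (s n)\<^sup>2"
        by (rule minimizer_gradient_translation[OF dim assms(7,8) D g1 \<rho> \<rho>2 b s(2,3)])
      finally show "(\<integral>x. (g (x + s n *\<^sub>R b) \<bullet> c - g x \<bullet> c)\<^sup>2 \<partial>lebesgue) \<le> 48 * (\<integral>x. (\<rho> x)\<^sup>2 \<partial>lebesgue) * (s n)\<^sup>2" .
    qed
    \<comment> \<open>The weak derivatives of one component of the gradient are found direction by
      direction; they are chosen simultaneously and assembled into the vector field
      \<open>h\<close>.\<close>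
    then have "\<forall>b\<in>Basis. \<exists>G. L2 lebesgue G \<and> (\<forall>\<phi>. test_fun \<phi> \<longrightarrow>
        (\<integral>x. (g x \<bullet> c) * partial b \<phi> x \<partial>lebesgue) = - (\<integral>x. G x * \<phi> x \<partial>lebesgue))" by blast
    from bchoice[OF this] obtain G where G: "\<forall>b\<in>Basis. L2 lebesgue (G b) \<and> (\<forall>\<phi>. test_fun \<phi> \<longrightarrow>
        (\<integral>x. (g x \<bullet> c) * partial b \<phi> x \<partial>lebesgue) = - (\<integral>x. G b x * \<phi> x \<partial>lebesgue))" by blast
    define h where "h x = (\<Sum>b\<in>Basis. G b x *\<^sub>R b)" for x
    have h: "h x \<bullet> b = G b x" if "b \<in> Basis" for b x
      using that unfolding h_def
      by (simp add: inner_sum_left inner_Basis if_distrib sum.delta cong: if_cong)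
    have hL: "L2 lebesgue (\<lambda>x. h x \<bullet> b)" if "b \<in> Basis" for b
      using G that by (simp add: h[OF that])
    have "has_weak_gradient (\<lambda>x. g x \<bullet> c) h"
      unfolding has_weak_gradient_def
      using L2_lebesgue_local(1)[OF gbL[OF c]] L2_lebesgue_local(1)[OF hL] G by (simp add: h)
    then show ?thesis using L2_lebesgue_local(2)[OF hL] by blast
  qed
  obtain L where "L-lipschitz_on UNIV u" using assms(7) by (auto simp: Xset_def)
  then have "L2_loc u" by (rule lipschitz_L2_loc)
  then show ?thesis
    unfolding W22_loc_def
    by (intro conjI exI[of _ g] ballI wg 2 L2_lebesgue_local(2)[OF gbL])
qed

end
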